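(* $\mathsf{RCA}_0$ proves the following statement. Let $X$ and $Y$ be sets, and let $\pi : X \to Y$ be a function with $\pi(a) \neq \pi(b)$ for some $a,b \in X$. Then $a$ and $b$ are not connected in the V-space induced by $\pi$.
   Context: $\mathsf{RCA}_0$ is the usual subsystem of second-order arithmetic (recursive comprehension). All notions are formalized in the language of second-order arithmetic: $\omega$ denotes the set of natural numbers (of the model), sets are subsets of it, and sequences of sets are coded by single sets in the usual way. A strong system of vicinities for $x$ in a non-empty set $X \subseteq \omega$ is a sequence $\mathcal{S} = \langle S_n : n \in I\rangle$, where $I$ is a non-empty (possibly finite) initial segment of $\omega$, $x \in S_n \subseteq X$ for all $n \in I$, and $S_n \neq S_m$ for all $n,m \in I$ with $n \neq m$. A strong V-space is a pair $(X,\{\mathcal{S}_x : x \in X\})$, where for each $x \in X$, $\mathcal{S}_x$ is a strong system of vicinities for $x$ in $X$; the terms of $\mathcal{S}_x$ are called the vicinities of $x$. The V-space induced by $\pi : X \to Y$ is the strong V-space on $X$ in which each $x \in X$ has exactly one vicinity, namely $\{y \in X : \pi(x) = \pi(y)\}$. ($\mathsf{RCA}_0$ proves that it exists, given $X$, $Y$ and $\pi$.) A cover of a V-space is a sequence $\langle V_x : x \in X\rangle$ such that $V_x$ is a vicinity of $x$ for each $x \in X$. Two elements $a,b \in X$ are connected in the V-space if for every cover $\langle V_x : x \in X\rangle$ there is a finite sequence $x_0,\ldots,x_k$ of elements of $X$ such that $a = x_0$, $b = x_k$, and $V_{x_j} \cap V_{x_{j+1}} \neq \emptyset$ for each $j <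 k$. *)

theory Defs
  imports Main
begin

section \<open>The language of second-order arithmetic\<close>

text \<open>
  Two-sorted first-order syntax with named variables.  Number variables and set variables are both
  named by strings, but they form separate name spaces: a number quantifier never binds a set
  variable, nor conversely.  Equality is primitive for numbers only; equality of sets is
  extensional equality, written out where it is needed.
\<close>

type_synonym var = string

datatype tm =
    Var var
  | Zero ("\<^bold>0")
  | One ("\<^bold>1")
  | Add tm tm (infixl "\<^bold>+" 65)
  | Mult tm tm (infixl "\<^bold>*" 70)

datatype fm =
    Eq tm tm (infix "\<^bold>=" 50)
  | Less tm tm (infix "\<^bold><" 50)
  | Mem tm var (infix "\<^bold>\<in>" 50)
  | Neg fm ("\<^bold>\<not> _" [40] 40)
  | Imp fm fm (infixr "\<^bold>\<longrightarrow>" 25)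
  | AllN var fm ("(3\<^bold>\<forall>_./ _)" [1000, 10] 10)
  | AllS var fm ("(3\<^bold>\<forall>\<^sub>2_./ _)" [1000, 10] 10)

abbreviation Conj :: "fm \<Rightarrow> fm \<Rightarrow> fm" (infixr "\<^bold>\<and>" 35) where
  "\<phi> \<^bold>\<and> \<psi> \<equiv> \<^bold>\<not> (\<phi> \<^bold>\<longrightarrow> \<^bold>\<not> \<psi>)"

abbreviation (input) Disj :: "fm \<Rightarrow> fm \<Rightarrow> fm" (infixr "\<^bold>\<or>" 30) where
  "\<phi> \<^bold>\<or> \<psi> \<equiv> \<^bold>\<not> \<phi> \<^bold>\<longrightarrow> \<psi>"

abbreviation Iff :: "fm \<Rightarrow> fm \<Rightarrow> fm" (infix "\<^bold>\<longleftrightarrow>" 25) where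
  "\<phi> \<^bold>\<longleftrightarrow> \<psi> \<equiv> (\<phi> \<^bold>\<longrightarrow> \<psi>) \<^bold>\<and> (\<psi> \<^bold>\<longrightarrow> \<phi>)"

abbreviation ExN :: "var \<Rightarrow> fm \<Rightarrow> fm" ("(3\<^bold>\<exists>_./ _)" [1000, 10] 10) where
  "\<^bold>\<exists>x. \<phi> \<equiv> \<^bold>\<not> (\<^bold>\<forall>x. \<^bold>\<not> \<phi>)"

abbreviation ExS :: "var \<Rightarrow> fm \<Rightarrow> fm" ("(3\<^bold>\<exists>\<^sub>2_./ _)" [1000, 10] 10) where
  "\<^bold>\<exists>\<^sub>2X. \<phi> \<equiv> \<^bold>\<not> (\<^bold>\<forall>\<^sub>2X. \<^bold>\<not> \<phi>)"

primrec vars_tm :: "tm \<Rightarrow> var set" where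
  "vars_tm (Var x) = {x}"
| "vars_tm \<^bold>0 = {}"
| "vars_tm \<^bold>1 = {}"
| "vars_tm (s \<^bold>+ t) = vars_tm s \<union> vars_tm t"
| "vars_tm (s \<^bold>* t) = vars_tm s \<union> vars_tm t"

primrec free_num :: "fm \<Rightarrow> var set" where
  "free_num (s \<^bold>= t) = vars_tm s \<union> vars_tm t"
| "free_num (s \<^bold>< t) = vars_tm s \<union> vars_tm t"
| "free_num (t \<^bold>\<in> X) = vars_tm t"
| "free_num (\<^bold>\<not> \<phi>) = free_num \<phi>"
| "free_num (\<phi> \<^bold>\<longrightarrow> \<psi>) = free_num \<phi> \<union> free_num \<psi>"
| "free_num (\<^bold>\<forall>x. \<phi>) = free_num \<phi> - {x}"
| "free_num (\<^bold>\<forall>\<^sub>2X. \<phi>) = free_num \<phi>"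

primrec free_set :: "fm \<Rightarrow> var set" where
  "free_set (s \<^bold>= t) = {}"
| "free_set (s \<^bold>< t) = {}"
| "free_set (t \<^bold>\<in> X) = {X}"
| "free_set (\<^bold>\<not> \<phi>) = free_set \<phi>"
| "free_set (\<phi> \<^bold>\<longrightarrow> \<psi>) = free_set \<phi> \<union> free_set \<psi>"
| "free_set (\<^bold>\<forall>x. \<phi>) = free_set \<phi>"
| "free_set (\<^bold>\<forall>\<^sub>2X. \<phi>) = free_set \<phi> - {X}"

text \<open>
  Substitution of a term for the free occurrences of a number variable, and of a set variable for
  the free occurrences of a set variable.  Bound variables are not renamed; the predicates
  \<open>num_free_for\<close> and \<open>set_free_for\<close> express that no variable is captured.
\<close>

primrec subst_tm :: "tm \<Rightarrow> var \<Rightarrow> tm \<Rightarrow> tm" where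
  "subst_tm t x (Var y) = (if y = x then t else Var y)"
| "subst_tm t x \<^bold>0 = \<^bold>0"
| "subst_tm t x \<^bold>1 = \<^bold>1"
| "subst_tm t x (r \<^bold>+ s) = subst_tm t x r \<^bold>+ subst_tm t x s"
| "subst_tm t x (r \<^bold>* s) = subst_tm t x r \<^bold>* subst_tm t x s"

primrec subst_num :: "tm \<Rightarrow> var \<Rightarrow> fm \<Rightarrow> fm" where
  "subst_num t x (r \<^bold>= s) = (subst_tm t x r \<^bold>= subst_tm t x s)"
| "subst_num t x (r \<^bold>< s) = (subst_tm t x r \<^bold>< subst_tm t x s)"
| "subst_num t x (r \<^bold>\<in> X) = (subst_tm t x r \<^bold>\<in> X)"
| "subst_num t x (\<^bold>\<not> \<phi>) = (\<^bold>\<not> subst_num t x \<phi>)"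
| "subst_num t x (\<phi> \<^bold>\<longrightarrow> \<psi>) = (subst_num t x \<phi> \<^bold>\<longrightarrow> subst_num t x \<psi>)"
| "subst_num t x (\<^bold>\<forall>y. \<phi>) = (\<^bold>\<forall>y. if y = x then \<phi> else subst_num t x \<phi>)"
| "subst_num t x (\<^bold>\<forall>\<^sub>2X. \<phi>) = (\<^bold>\<forall>\<^sub>2X. subst_num t x \<phi>)"

primrec num_free_for :: "tm \<Rightarrow> var \<Rightarrow> fm \<Rightarrow> bool" where
  "num_free_for t x (r \<^bold>= s) \<longleftrightarrow> True"
| "num_free_for t x (r \<^bold>< s) \<longleftrightarrow> True"
| "num_free_for t x (r \<^bold>\<in> X) \<longleftrightarrow> True"
| "num_free_for t x (\<^bold>\<not> \<phi>) \<longleftrightarrow> num_free_for t x \<phi>"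
| "num_free_for t x (\<phi> \<^bold>\<longrightarrow> \<psi>) \<longleftrightarrow> num_free_for t x \<phi> \<and> num_free_for t x \<psi>"
| "num_free_for t x (\<^bold>\<forall>y. \<phi>) \<longleftrightarrow> x \<notin> free_num (\<^bold>\<forall>y. \<phi>) \<or> y \<notin> vars_tm t \<and> num_free_for t x \<phi>"
| "num_free_for t x (\<^bold>\<forall>\<^sub>2X. \<phi>) \<longleftrightarrow> num_free_for t x \<phi>"

primrec subst_set :: "var \<Rightarrow> var \<Rightarrow> fm \<Rightarrow> fm" where
  "subst_set Y X (r \<^bold>= s) = (r \<^bold>= s)"
| "subst_set Y X (r \<^bold>< s) = (r \<^bold>< s)"
| "subst_set Y X (r \<^bold>\<in> Z) = (r \<^bold>\<in> (if Z = X then Y else Z))"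
| "subst_set Y X (\<^bold>\<not> \<phi>) = (\<^bold>\<not> subst_set Y X \<phi>)"
| "subst_set Y X (\<phi> \<^bold>\<longrightarrow> \<psi>) = (subst_set Y X \<phi> \<^bold>\<longrightarrow> subst_set Y X \<psi>)"
| "subst_set Y X (\<^bold>\<forall>x. \<phi>) = (\<^bold>\<forall>x. subst_set Y X \<phi>)"
| "subst_set Y X (\<^bold>\<forall>\<^sub>2Z. \<phi>) = (\<^bold>\<forall>\<^sub>2Z. if Z = X then \<phi> else subst_set Y X \<phi>)"

primrec set_free_for :: "var \<Rightarrow> var \<Rightarrow> fm \<Rightarrow> bool" where
  "set_free_for Y X (r \<^bold>= s) \<longleftrightarrow> True"
| "set_free_for Y X (r \<^bold>< s) \<longleftrightarrow> True"
| "set_free_for Y X (r \<^bold>\<in> Z) \<longleftrightarrow> True"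
| "set_free_for Y X (\<^bold>\<not> \<phi>) \<longleftrightarrow> set_free_for Y X \<phi>"
| "set_free_for Y X (\<phi> \<^bold>\<longrightarrow> \<psi>) \<longleftrightarrow> set_free_for Y X \<phi> \<and> set_free_for Y X \<psi>"
| "set_free_for Y X (\<^bold>\<forall>x. \<phi>) \<longleftrightarrow> set_free_for Y X \<phi>"
| "set_free_for Y X (\<^bold>\<forall>\<^sub>2Z. \<phi>) \<longleftrightarrow> X \<notin> free_set (\<^bold>\<forall>\<^sub>2Z. \<phi>) \<or> Z \<noteq> Y \<and> set_free_for Y X \<phi>"


section \<open>Provability\<close>

text \<open>
  A Hilbert calculus for classical two-sorted first-order logic with equality of numbers
  (Mendelson style).  Generalisation is unrestricted, so a formula with free variables in \<open>T\<close> acts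
  as its universal closure.  No comprehension is built into the logic.
\<close>

inductive proves :: "fm set \<Rightarrow> fm \<Rightarrow> bool" (infix "\<turnstile>" 5) for T :: "fm set" where
  Axiom: "\<phi> \<in> T \<Longrightarrow> T \<turnstile> \<phi>"
| K: "T \<turnstile> \<phi> \<^bold>\<longrightarrow> \<psi> \<^bold>\<longrightarrow> \<phi>"
| S: "T \<turnstile> (\<phi> \<^bold>\<longrightarrow> \<psi> \<^bold>\<longrightarrow> \<chi>) \<^bold>\<longrightarrow> (\<phi> \<^bold>\<longrightarrow> \<psi>) \<^bold>\<longrightarrow> \<phi> \<^bold>\<longrightarrow> \<chi>"
| Contrapos: "T \<turnstile> (\<^bold>\<not> \<phi> \<^bold>\<longrightarrow> \<^bold>\<not> \<psi>) \<^bold>\<longrightarrow> \<psi> \<^bold>\<longrightarrow> \<phi>"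
| MP: "T \<turnstile> \<phi> \<^bold>\<longrightarrow> \<psi> \<Longrightarrow> T \<turnstile> \<phi> \<Longrightarrow> T \<turnstile> \<psi>"
| Inst_num: "num_free_for t x \<phi> \<Longrightarrow> T \<turnstile> (\<^bold>\<forall>x. \<phi>) \<^bold>\<longrightarrow> subst_num t x \<phi>"
| Inst_set: "set_free_for Y X \<phi> \<Longrightarrow> T \<turnstile> (\<^bold>\<forall>\<^sub>2X. \<phi>) \<^bold>\<longrightarrow> subst_set Y X \<phi>"
| Distr_num: "x \<notin> free_num \<phi> \<Longrightarrow> T \<turnstile> (\<^bold>\<forall>x. \<phi> \<^bold>\<longrightarrow> \<psi>) \<^bold>\<longrightarrow> \<phi> \<^bold>\<longrightarrow> (\<^bold>\<forall>x. \<psi>)"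
| Distr_set: "X \<notin> free_set \<phi> \<Longrightarrow> T \<turnstile> (\<^bold>\<forall>\<^sub>2X. \<phi> \<^bold>\<longrightarrow> \<psi>) \<^bold>\<longrightarrow> \<phi> \<^bold>\<longrightarrow> (\<^bold>\<forall>\<^sub>2X. \<psi>)"
| Gen_num: "T \<turnstile> \<phi> \<Longrightarrow> T \<turnstile> \<^bold>\<forall>x. \<phi>"
| Gen_set: "T \<turnstile> \<phi> \<Longrightarrow> T \<turnstile> \<^bold>\<forall>\<^sub>2X. \<phi>"
| Refl: "T \<turnstile> t \<^bold>= t"
| Leibniz: "num_free_for s x \<phi> \<Longrightarrow> num_free_for t x \<phi> \<Longrightarrow>
    T \<turnstile> s \<^bold>= t \<^bold>\<longrightarrow> subst_num s x \<phi> \<^bold>\<longrightarrow> subst_num t x \<phi>"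


section \<open>The axioms of RCA0\<close>

inductive bounded :: "fm \<Rightarrow> bool" where
  "bounded (s \<^bold>= t)"
| "bounded (s \<^bold>< t)"
| "bounded (t \<^bold>\<in> X)"
| "bounded \<phi> \<Longrightarrow> bounded (\<^bold>\<not> \<phi>)"
| "bounded \<phi> \<Longrightarrow> bounded \<psi> \<Longrightarrow> bounded (\<phi> \<^bold>\<longrightarrow> \<psi>)"
| "bounded \<phi> \<Longrightarrow> x \<notin> vars_tm t \<Longrightarrow> bounded (\<^bold>\<forall>x. Var x \<^bold>< t \<^bold>\<longrightarrow> \<phi>)"
| "bounded \<phi> \<Longrightarrow> x \<notin> vars_tm t \<Longrightarrow> bounded (\<^bold>\<exists>x. Var x \<^bold>< t \<^bold>\<and> \<phi>)"

inductive Sigma01 :: "fm \<Rightarrow> bool" where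
  "bounded \<theta> \<Longrightarrow> Sigma01 (\<^bold>\<exists>x. \<theta>)"

inductive Pi01 :: "fm \<Rightarrow> bool" where
  "bounded \<theta> \<Longrightarrow> Pi01 (\<^bold>\<forall>x. \<theta>)"

definition basic_axioms :: "fm set" where
  "basic_axioms = (let m = Var ''m''; n = Var ''n'' in
    { \<^bold>\<not> (n \<^bold>+ \<^bold>1 \<^bold>= \<^bold>0),
      m \<^bold>+ \<^bold>1 \<^bold>= n \<^bold>+ \<^bold>1 \<^bold>\<longrightarrow> m \<^bold>= n,
      m \<^bold>+ \<^bold>0 \<^bold>= m,
      m \<^bold>+ (n \<^bold>+ \<^bold>1) \<^bold>= (m \<^bold>+ n) \<^bold>+ \<^bold>1,
      m \<^bold>* \<^bold>0 \<^bold>= \<^bold>0,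
      m \<^bold>* (n \<^bold>+ \<^bold>1) \<^bold>= (m \<^bold>* n) \<^bold>+ m,
      \<^bold>\<not> (m \<^bold>< \<^bold>0),
      m \<^bold>< n \<^bold>+ \<^bold>1 \<^bold>\<longleftrightarrow> (m \<^bold>< n \<^bold>\<or> m \<^bold>= n) })"

definition Sigma01_induction :: "fm set" where
  "Sigma01_induction =
    {subst_num \<^bold>0 x \<phi> \<^bold>\<and> (\<^bold>\<forall>x. \<phi> \<^bold>\<longrightarrow> subst_num (Var x \<^bold>+ \<^bold>1) x \<phi>) \<^bold>\<longrightarrow> (\<^bold>\<forall>x. \<phi>) | x \<phi>. Sigma01 \<phi>}"

definition Delta01_comprehension :: "fm set" where
  "Delta01_comprehension =
    {(\<^bold>\<forall>x. \<phi> \<^bold>\<longleftrightarrow> \<psi>) \<^bold>\<longrightarrow> (\<^bold>\<exists>\<^sub>2X. \<^bold>\<forall>x. Var x \<^bold>\<in> X \<^bold>\<longleftrightarrow> \<phi>) | x X \<phi> \<psi>.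
      Sigma01 \<phi> \<and> Pi01 \<psi> \<and> X \<notin> free_set \<phi>}"

definition RCA0 :: "fm set" where
  "RCA0 = basic_axioms \<union> Sigma01_induction \<union> Delta01_comprehension"


section \<open>Functions and V-spaces in second-order arithmetic\<close>

text \<open>
  The definitions below are formula templates: an argument of type \<^typ>\<open>var\<close> names a set variable,
  an argument of type \<^typ>\<open>tm\<close> is a number.  Number arguments must not contain the number variables
  that the template itself binds; this holds for all uses below.

  Pairs are coded by \<open>(i, j) = (i + j)\<^sup>2 + i\<close>, and a sequence of sets by the single set whose
  \<open>n\<close>-th section \<open>{i. (i, n) \<in> X}\<close> is the \<open>n\<close>-th term.
\<close>

definition pair :: "tm \<Rightarrow> tm \<Rightarrow> tm" where
  "pair s t = (s \<^bold>+ t) \<^bold>* (s \<^bold>+ t) \<^bold>+ s"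

text \<open>\<open>P : X \<rightarrow> Y\<close>, as a set of pairs\<close>
definition is_function :: "var \<Rightarrow> var \<Rightarrow> var \<Rightarrow> fm" where
  "is_function P X Y = (let x = Var ''x''; y = Var ''y''; y' = Var ''y1''; z = Var ''z'' in
    (\<^bold>\<forall>''z''. z \<^bold>\<in> P \<^bold>\<longrightarrow> (\<^bold>\<exists>''x''. \<^bold>\<exists>''y''. x \<^bold>\<in> X \<^bold>\<and> y \<^bold>\<in> Y \<^bold>\<and> z \<^bold>= pair x y)) \<^bold>\<and>
    (\<^bold>\<forall>''x''. x \<^bold>\<in> X \<^bold>\<longrightarrow>
      (\<^bold>\<exists>''y''. pair x y \<^bold>\<in> P \<^bold>\<and> (\<^bold>\<forall>''y1''. pair x y' \<^bold>\<in> P \<^bold>\<longrightarrow> y' \<^bold>= y))))"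

text \<open>\<open>P(s) = P(t)\<close>\<close>
definition same_value :: "var \<Rightarrow> tm \<Rightarrow> tm \<Rightarrow> fm" where
  "same_value P s t = (let w = Var ''w'' in \<^bold>\<exists>''w''. pair s w \<^bold>\<in> P \<^bold>\<and> pair t w \<^bold>\<in> P)"

text \<open>
  A V-space on \<open>X\<close> is coded by two sets: the section \<open>I\<^sub>x = {n. (n, x) \<in> I}\<close> is the index set of the
  system of vicinities of \<open>x\<close>, and \<open>{y. ((y, n), x) \<in> S}\<close> is its \<open>n\<close>-th term, i.e. \<open>S\<close> codes a
  sequence (indexed by \<open>x\<close>) of sequences (indexed by \<open>n\<close>) of sets.
\<close>

definition is_index :: "var \<Rightarrow> tm \<Rightarrow> tm \<Rightarrow> fm" where
  "is_index I x n = (pair n x \<^bold>\<in> I)"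

definition in_vicinity :: "var \<Rightarrow> tm \<Rightarrow> tm \<Rightarrow> tm \<Rightarrow> fm" where
  "in_vicinity S x n y = (pair (pair y n) x \<^bold>\<in> S)"

definition strong_V_space :: "var \<Rightarrow> var \<Rightarrow> var \<Rightarrow> fm" where
  "strong_V_space X I S =
    (let x = Var ''x''; y = Var ''y''; n = Var ''n''; m = Var ''m'' in
    (\<^bold>\<exists>''x''. x \<^bold>\<in> X) \<^bold>\<and>
    (\<^bold>\<forall>''x''. x \<^bold>\<in> X \<^bold>\<longrightarrow>
      (\<^bold>\<exists>''n''. is_index I x n) \<^bold>\<and>
      (\<^bold>\<forall>''n''. \<^bold>\<forall>''m''. is_index I x n \<^bold>\<and> m \<^bold>< n \<^bold>\<longrightarrow> is_index I x m) \<^bold>\<and>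
      (\<^bold>\<forall>''n''. is_index I x n \<^bold>\<longrightarrow>
        in_vicinity S x n x \<^bold>\<and> (\<^bold>\<forall>''y''. in_vicinity S x n y \<^bold>\<longrightarrow> y \<^bold>\<in> X)) \<^bold>\<and>
      (\<^bold>\<forall>''n''. \<^bold>\<forall>''m''. is_index I x n \<^bold>\<and> is_index I x m \<^bold>\<and> \<^bold>\<not> n \<^bold>= m \<^bold>\<longrightarrow>
        \<^bold>\<not> (\<^bold>\<forall>''y''. in_vicinity S x n y \<^bold>\<longleftrightarrow> in_vicinity S x m y))))"

text \<open>
  Since index sets are non-empty, it is enough to say that every vicinity of \<open>x\<close> is
  \<open>{y \<in> X. P(x) = P(y)}\<close>; then \<open>x\<close> has exactly one vicinity.
\<close>
definition induced_V_space :: "var \<Rightarrow> var \<Rightarrow> var \<Rightarrow> var \<Rightarrow> fm" where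
  "induced_V_space P X I S =
    (let x = Var ''x''; y = Var ''y''; n = Var ''n'' in
    strong_V_space X I S \<^bold>\<and>
    (\<^bold>\<forall>''x''. \<^bold>\<forall>''n''. x \<^bold>\<in> X \<^bold>\<and> is_index I x n \<^bold>\<longrightarrow>
      (\<^bold>\<forall>''y''. in_vicinity S x n y \<^bold>\<longleftrightarrow> y \<^bold>\<in> X \<^bold>\<and> same_value P x y)))"

text \<open>\<open>V\<close> codes a cover \<open>\<langle>V\<^sub>x : x \<in> X\<rangle>\<close>, where \<open>V\<^sub>x = {y. (y, x) \<in> V}\<close>.\<close>
definition is_cover :: "var \<Rightarrow> var \<Rightarrow> var \<Rightarrow> var \<Rightarrow> fm" where
  "is_cover X I S V =
    (let x = Var ''x''; y = Var ''y''; n = Var ''n'' in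
    \<^bold>\<forall>''x''. x \<^bold>\<in> X \<^bold>\<longrightarrow>
      (\<^bold>\<exists>''n''. is_index I x n \<^bold>\<and> (\<^bold>\<forall>''y''. pair y x \<^bold>\<in> V \<^bold>\<longleftrightarrow> in_vicinity S x n y)))"

text \<open>
  \<open>F\<close> is a finite sequence \<open>\<langle>x\<^sub>0, \<dots>, x\<^sub>k\<rangle>\<close> of elements of \<open>X\<close>: a finite set of pairs which is the graph of a
  function from \<open>{i. i \<le> k}\<close> to \<open>X\<close>.
\<close>
definition is_finite_sequence :: "var \<Rightarrow> tm \<Rightarrow> var \<Rightarrow> fm" where
  "is_finite_sequence F k X =
    (let i = Var ''i''; u = Var ''u''; u' = Var ''u1''; z = Var ''z'' in
    (\<^bold>\<forall>''z''. z \<^bold>\<in> F \<^bold>\<longrightarrow>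
      (\<^bold>\<exists>''i''. \<^bold>\<exists>''u''. i \<^bold>< k \<^bold>+ \<^bold>1 \<^bold>\<and> u \<^bold>\<in> X \<^bold>\<and> z \<^bold>= pair i u)) \<^bold>\<and>
    (\<^bold>\<forall>''i''. i \<^bold>< k \<^bold>+ \<^bold>1 \<^bold>\<longrightarrow>
      (\<^bold>\<exists>''u''. pair i u \<^bold>\<in> F \<^bold>\<and> (\<^bold>\<forall>''u1''. pair i u' \<^bold>\<in> F \<^bold>\<longrightarrow> u' \<^bold>= u))))"

definition connected :: "var \<Rightarrow> var \<Rightarrow> var \<Rightarrow> tm \<Rightarrow> tm \<Rightarrow> fm" where
  "connected X I S a b =
    (let j = Var ''j''; k = Var ''k''; u = Var ''u''; v = Var ''v''; y = Var ''y'' in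
    \<^bold>\<forall>\<^sub>2''V''. is_cover X I S ''V'' \<^bold>\<longrightarrow>
      (\<^bold>\<exists>\<^sub>2''F''. \<^bold>\<exists>''k''. is_finite_sequence ''F'' k X \<^bold>\<and>
        pair \<^bold>0 a \<^bold>\<in> ''F'' \<^bold>\<and> pair k b \<^bold>\<in> ''F'' \<^bold>\<and>
        (\<^bold>\<forall>''j''. j \<^bold>< k \<^bold>\<longrightarrow>
          (\<^bold>\<exists>''u''. \<^bold>\<exists>''v''. pair j u \<^bold>\<in> ''F'' \<^bold>\<and> pair (j \<^bold>+ \<^bold>1) v \<^bold>\<in> ''F'' \<^bold>\<and>
            (\<^bold>\<exists>''y''. pair y u \<^bold>\<in> ''V'' \<^bold>\<and> pair y v \<^bold>\<in> ''V'')))))"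

end

theory Submission
  imports Defs "HOL-Library.Countable_Set"
begin

text \<open>
  By a completeness theorem for the calculus it suffices to argue inside an arbitrary (possibly
  nonstandard) model of RCA0. The Henkin model uses variables as witnesses, so no constants are added to
  the language.

  In a model, \<open>\<pi>(x) = \<pi>(y)\<close> is a \<open>\<Delta>\<^sup>0\<^sub>1\<close> relation, so the induced V-space exists. Its only cover
  consists of the fibres of \<open>\<pi>\<close>. Two fibres that meet coincide, so \<open>\<Sigma>\<^sup>0\<^sub>1\<close> induction along a chain
  from \<open>a\<close> shows that every element of the chain has the value \<open>\<pi>(a)\<close>; hence \<open>b\<close> is never reached.
\<close>

section \<open>Derived rules of the calculus\<close>

text \<open>Substitution does not rename bound variables, so terms and sets cannot be substituted
  freely: in the truth lemma they are exchanged for variables outside a prescribed finite set that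
  name the same object. Sets have no primitive equality, so such a name of a set is only coextensive
  with it. The numbers of a model satisfy only what the axioms give; the laws of arithmetic that
  pairing relies on, up to its injectivity, have to be extracted from the induction scheme through
  explicit formulas. Comprehension is delicate only for the fibres: a common value of x and y has no
  bound in terms of the code of (x, y), so its quantifier cannot be bounded, and both an existential
  and a universal form are required. In the induction along a chain, the value \<pi>(a) is kept as a
  fixed parameter, which leaves a single existential quantifier.\<close>

lemma proves_imp_refl: "T \<turnstile> \<phi> \<^bold>\<longrightarrow> \<phi>"
  using S[of T \<phi> "\<phi> \<^bold>\<longrightarrow> \<phi>" \<phi>] K[of T \<phi> "\<phi> \<^bold>\<longrightarrow> \<phi>"] K[of T \<phi> \<phi>] by (blast intro: MP)

lemma proves_weaken: "T \<turnstile> \<psi> \<Longrightarrow> T \<turnstile> \<phi> \<^bold>\<longrightarrow> \<psi>"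
  using K MP by blast

lemma proves_imp_mp: "T \<turnstile> \<phi> \<^bold>\<longrightarrow> \<psi> \<^bold>\<longrightarrow> \<chi> \<Longrightarrow> T \<turnstile> \<phi> \<^bold>\<longrightarrow> \<psi> \<Longrightarrow> T \<turnstile> \<phi> \<^bold>\<longrightarrow> \<chi>"
  using S MP by blast

lemma proves_imp_trans: "T \<turnstile> \<phi> \<^bold>\<longrightarrow> \<psi> \<Longrightarrow> T \<turnstile> \<psi> \<^bold>\<longrightarrow> \<chi> \<Longrightarrow> T \<turnstile> \<phi> \<^bold>\<longrightarrow> \<chi>"
  using proves_imp_mp proves_weaken by blast

lemma proves_ex_falso: "T \<turnstile> \<^bold>\<not> \<phi> \<^bold>\<longrightarrow> \<phi> \<^bold>\<longrightarrow> \<psi>"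
  using proves_imp_trans[OF K Contrapos] .

text \<open>\<open>Contrapos\<close> is the only axiom about negation. The hypothesis yields both
  \<open>\<phi>\<close> and its negation from the negation of \<open>\<phi>\<close>, hence the
  negation of the theorem \<open>?c\<close>; contraposition then gives \<open>\<phi>\<close> from
  \<open>?c\<close>.\<close>

lemma proves_clavius: "T \<turnstile> (\<^bold>\<not> \<phi> \<^bold>\<longrightarrow> \<phi>) \<^bold>\<longrightarrow> \<phi>"
proof -
  let ?c = "\<phi> \<^bold>\<longrightarrow> \<phi>"
  have "T \<turnstile> (\<^bold>\<not> \<phi> \<^bold>\<longrightarrow> \<phi>) \<^bold>\<longrightarrow> \<^bold>\<not> \<phi> \<^bold>\<longrightarrow> \<^bold>\<not> ?c"
    by (rule MP[OF S proves_ex_falso])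
  then have "T \<turnstile> (\<^bold>\<not> \<phi> \<^bold>\<longrightarrow> \<phi>) \<^bold>\<longrightarrow> ?c \<^bold>\<longrightarrow> \<phi>"
    using Contrapos proves_imp_trans by blast
  then show ?thesis
    using proves_imp_mp proves_weaken proves_imp_refl by blast
qed

lemma proves_dne: "T \<turnstile> \<^bold>\<not> \<^bold>\<not> \<phi> \<^bold>\<longrightarrow> \<phi>"
  using proves_imp_trans[OF proves_ex_falso proves_clavius] .

lemma proves_dni: "T \<turnstile> \<phi> \<^bold>\<longrightarrow> \<^bold>\<not> \<^bold>\<not> \<phi>"
  using MP[OF Contrapos proves_dne] .

lemma proves_contrapos: "T \<turnstile> \<phi> \<^bold>\<longrightarrow> \<psi> \<Longrightarrow> T \<turnstile> \<^bold>\<not> \<psi> \<^bold>\<longrightarrow> \<^bold>\<not> \<phi>"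
  by (meson MP Contrapos proves_dne proves_dni proves_imp_trans)

lemma proves_not: "T \<turnstile> \<phi> \<^bold>\<longrightarrow> \<psi> \<Longrightarrow> T \<turnstile> \<phi> \<^bold>\<longrightarrow> \<^bold>\<not> \<psi> \<Longrightarrow> T \<turnstile> \<^bold>\<not> \<phi>"
  by (meson MP proves_clavius proves_contrapos proves_dne proves_imp_trans)

lemma proves_conjD1: "T \<turnstile> \<phi> \<^bold>\<and> \<psi> \<^bold>\<longrightarrow> \<phi>"
  using proves_imp_trans[OF proves_contrapos[OF proves_ex_falso] proves_dne] .

lemma proves_conjD2: "T \<turnstile> \<phi> \<^bold>\<and> \<psi> \<^bold>\<longrightarrow> \<psi>"
  using proves_imp_trans[OF proves_contrapos[OF K] proves_dne] .

lemma proves_conjI: "T \<turnstile> \<phi> \<Longrightarrow> T \<turnstile> \<psi> \<Longrightarrow> T \<turnstile> \<phi> \<^bold>\<and> \<psi>"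
  by (rule proves_not[OF proves_weaken proves_imp_mp[OF proves_imp_refl proves_weaken]])

text \<open>Conjunction abbreviates a negated implication, so its negation is a double
  negation.\<close>

lemma proves_not_conjD: "T \<turnstile> \<^bold>\<not> (\<phi> \<^bold>\<and> \<psi>) \<Longrightarrow> T \<turnstile> \<phi> \<^bold>\<longrightarrow> \<^bold>\<not> \<psi>"
  using MP[OF proves_dne] .

lemma proves_not_conj_notD: "T \<turnstile> \<^bold>\<not> (\<phi> \<^bold>\<and> \<^bold>\<not> \<psi>) \<Longrightarrow> T \<turnstile> \<phi> \<^bold>\<longrightarrow> \<psi>"
  using proves_imp_trans[OF proves_not_conjD proves_dne] .


section \<open>Fresh variables\<close>

text \<open>Bound variables are included: a variable outside this set can be substituted without
  capture, and the substitution can be undone by another one.\<close>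

primrec all_num :: "fm \<Rightarrow> var set" where
  "all_num (s \<^bold>= t) = vars_tm s \<union> vars_tm t"
| "all_num (s \<^bold>< t) = vars_tm s \<union> vars_tm t"
| "all_num (t \<^bold>\<in> X) = vars_tm t"
| "all_num (\<^bold>\<not> \<phi>) = all_num \<phi>"
| "all_num (\<phi> \<^bold>\<longrightarrow> \<psi>) = all_num \<phi> \<union> all_num \<psi>"
| "all_num (\<^bold>\<forall>x. \<phi>) = insert x (all_num \<phi>)"
| "all_num (\<^bold>\<forall>\<^sub>2X. \<phi>) = all_num \<phi>"

primrec all_set :: "fm \<Rightarrow> var set" where
  "all_set (s \<^bold>= t) = {}"
| "all_set (s \<^bold>< t) = {}"
| "all_set (t \<^bold>\<in> X) = {X}"
| "all_set (\<^bold>\<not> \<phi>) = all_set \<phi>"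
| "all_set (\<phi> \<^bold>\<longrightarrow> \<psi>) = all_set \<phi> \<union> all_set \<psi>"
| "all_set (\<^bold>\<forall>x. \<phi>) = all_set \<phi>"
| "all_set (\<^bold>\<forall>\<^sub>2X. \<phi>) = insert X (all_set \<phi>)"

lemma finite_vars_tm [simp]: "finite (vars_tm t)"
  by (induction t) auto

lemma finite_all_num [simp]: "finite (all_num \<phi>)"
  by (induction \<phi>) auto

lemma finite_all_set [simp]: "finite (all_set \<phi>)"
  by (induction \<phi>) auto

lemma free_num_subset: "free_num \<phi> \<subseteq> all_num \<phi>"
  by (induction \<phi>) auto

lemma free_set_subset: "free_set \<phi> \<subseteq> all_set \<phi>"
  by (induction \<phi>) auto

lemma finite_free_num [simp]: "finite (free_num \<phi>)"
  using finite_subset[OF free_num_subset] by simp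

lemma finite_free_set [simp]: "finite (free_set \<phi>)"
  using finite_subset[OF free_set_subset] by simp

lemma fresh_var:
  assumes "finite A"
  obtains x :: var where "x \<notin> A"
  using ex_new_if_finite[OF infinite_UNIV_listI assms] by blast

lemma subst_tm_fresh [simp]: "x \<notin> vars_tm s \<Longrightarrow> subst_tm t x s = s"
  by (induction s) auto

lemma subst_num_fresh [simp]: "x \<notin> all_num \<phi> \<Longrightarrow> subst_num t x \<phi> = \<phi>"
  by (induction \<phi>) auto

lemma subst_set_fresh [simp]: "X \<notin> all_set \<phi> \<Longrightarrow> subst_set Y X \<phi> = \<phi>"
  by (induction \<phi>) auto

lemma num_free_for_fresh: "y \<notin> all_num \<phi> \<Longrightarrow> num_free_for (Var y) x \<phi>"
  by (induction \<phi>) auto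

lemma set_free_for_fresh: "Y \<notin> all_set \<phi> \<Longrightarrow> set_free_for Y X \<phi>"
  by (induction \<phi>) auto

lemma num_free_for_not_free: "x \<notin> all_num \<phi> \<Longrightarrow> num_free_for t x \<phi>"
  using free_num_subset by (induction \<phi>) fastforce+

lemma set_free_for_not_free: "X \<notin> all_set \<phi> \<Longrightarrow> set_free_for Y X \<phi>"
  using free_set_subset by (induction \<phi>) fastforce+

lemma subst_tm_back: "y \<notin> vars_tm s \<Longrightarrow> subst_tm (Var x) y (subst_tm (Var y) x s) = s"
  by (induction s) auto

lemma subst_num_back: "y \<notin> all_num \<phi> \<Longrightarrow> subst_num (Var x) y (subst_num (Var y) x \<phi>) = \<phi>"
  by (induction \<phi>) (auto simp: subst_tm_back)

lemma subst_set_back: "Y \<notin> all_set \<phi> \<Longrightarrow> subst_set X Y (subst_set Y X \<phi>) = \<phi>"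
  by (induction \<phi>) auto

text \<open>Only a quantifier over \<open>x\<close> could capture, and substitution for
  \<open>x\<close> leaves the body of such a quantifier untouched, so \<open>y\<close> does not
  occur there.\<close>

lemma num_free_for_back: "y \<notin> all_num \<phi> \<Longrightarrow> num_free_for (Var x) y (subst_num (Var y) x \<phi>)"
  using free_num_subset by (induction \<phi>) (auto simp: num_free_for_not_free)

lemma set_free_for_back: "Y \<notin> all_set \<phi> \<Longrightarrow> set_free_for X Y (subst_set Y X \<phi>)"
  using free_set_subset by (induction \<phi>) (auto simp: set_free_for_not_free)

lemma vars_subst_tm: "vars_tm (subst_tm t x s) \<subseteq> vars_tm s - {x} \<union> vars_tm t"
  by (induction s) auto

lemma free_num_subst: "free_num (subst_num t x \<phi>) \<subseteq> free_num \<phi> - {x} \<union> vars_tm t"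
proof (induction \<phi>)
  case (Eq r s) then show ?case using vars_subst_tm[of t x r] vars_subst_tm[of t x s] by auto
next
  case (Less r s) then show ?case using vars_subst_tm[of t x r] vars_subst_tm[of t x s] by auto
next
  case (Mem r X) then show ?case using vars_subst_tm[of t x r] by auto
qed auto

lemma free_set_subst: "free_set (subst_set Y X \<phi>) \<subseteq> free_set \<phi> - {X} \<union> {Y}"
  by (induction \<phi>) auto

text \<open>The calculus has no rule for renaming bound variables. Instantiating \<open>y\<close> by
  \<open>x\<close> undoes the substitution, and \<open>x\<close> can then be generalised because,
  with \<open>y \<noteq> x\<close>, it is not free on the left.\<close>

lemma proves_rename_num:
  assumes "y \<notin> all_num \<phi>" "y \<noteq> x"
  shows "T \<turnstile> (\<^bold>\<forall>y. subst_num (Var y) x \<phi>) \<^bold>\<longrightarrow> (\<^bold>\<forall>x. \<phi>)"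
proof -
  have "T \<turnstile> (\<^bold>\<forall>y. subst_num (Var y) x \<phi>) \<^bold>\<longrightarrow> \<phi>"
    using Inst_num[OF num_free_for_back[OF assms(1), of x], of T] assms(1)
    by (simp add: subst_num_back)
  moreover have "x \<notin> free_num (\<^bold>\<forall>y. subst_num (Var y) x \<phi>)"
    using free_num_subst[of "Var y" x \<phi>] assms by auto
  ultimately show ?thesis
    using MP[OF Distr_num Gen_num] by blast
qed

lemma proves_rename_set:
  assumes "Y \<notin> all_set \<phi>" "Y \<noteq> X"
  shows "T \<turnstile> (\<^bold>\<forall>\<^sub>2Y. subst_set Y X \<phi>) \<^bold>\<longrightarrow> (\<^bold>\<forall>\<^sub>2X. \<phi>)"
proof -
  have "T \<turnstile> (\<^bold>\<forall>\<^sub>2Y. subst_set Y X \<phi>) \<^bold>\<longrightarrow> \<phi>"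
    using Inst_set[OF set_free_for_back[OF assms(1), of X], of T] assms(1)
    by (simp add: subst_set_back)
  moreover have "X \<notin> free_set (\<^bold>\<forall>\<^sub>2Y. subst_set Y X \<phi>)"
    using free_set_subst[of Y X \<phi>] assms by auto
  ultimately show ?thesis
    using MP[OF Distr_set Gen_set] by blast
qed


section \<open>Saturated sets of formulas\<close>

text \<open>A maximal consistent Henkin theory in the original language. Free variables act as
  constants in it, which is why closure under generalisation is not demanded.\<close>

locale saturated =
  fixes T \<Gamma> :: "fm set"
  assumes provable: "T \<turnstile> \<phi> \<Longrightarrow> \<phi> \<in> \<Gamma>"
    and mp: "(\<phi> \<^bold>\<longrightarrow> \<psi>) \<in> \<Gamma> \<Longrightarrow> \<phi> \<in> \<Gamma> \<Longrightarrow> \<psi> \<in> \<Gamma>"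
    and neg_iff: "(\<^bold>\<not> \<phi>) \<in> \<Gamma> \<longleftrightarrow> \<phi> \<notin> \<Gamma>"
    and witness_num: "finite A \<Longrightarrow> (\<^bold>\<forall>x. \<phi>) \<notin> \<Gamma> \<Longrightarrow> \<exists>y. y \<notin> A \<and> subst_num (Var y) x \<phi> \<notin> \<Gamma>"
    and witness_set: "finite A \<Longrightarrow> (\<^bold>\<forall>\<^sub>2X. \<phi>) \<notin> \<Gamma> \<Longrightarrow> \<exists>Y. Y \<notin> A \<and> subst_set Y X \<phi> \<notin> \<Gamma>"

text \<open>The list records variables which a witness against a universal statement has to avoid. Having
  witnesses outside any prescribed finite set is what replaces the renaming of bound variables below.\<close>
definition decides :: "fm set \<Rightarrow> fm \<Rightarrow> fm \<times> var list \<Rightarrow> bool" where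
  "decides T \<gamma> = (\<lambda>(\<chi>, xs). (T \<turnstile> \<gamma> \<^bold>\<longrightarrow> \<chi>) \<or> (T \<turnstile> \<gamma> \<^bold>\<longrightarrow> \<^bold>\<not> \<chi>) \<and>
    (\<forall>x \<phi>. \<chi> = (\<^bold>\<forall>x. \<phi>) \<longrightarrow> (\<exists>y. y \<notin> set xs \<and> (T \<turnstile> \<gamma> \<^bold>\<longrightarrow> \<^bold>\<not> subst_num (Var y) x \<phi>))) \<and>
    (\<forall>X \<phi>. \<chi> = (\<^bold>\<forall>\<^sub>2X. \<phi>) \<longrightarrow> (\<exists>Y. Y \<notin> set xs \<and> (T \<turnstile> \<gamma> \<^bold>\<longrightarrow> \<^bold>\<not> subst_set Y X \<phi>))))"

text \<open>One step of the Lindenbaum-Henkin construction. A stage is a single formula, so only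
  finitely many variables occur in it and a fresh one is always available as a witness: if the stage
  proved the instance at the fresh variable, generalisation and renaming would make it prove the
  universal statement.\<close>

lemma consistent_decide:
  assumes cons: "\<not> (T \<turnstile> \<^bold>\<not> \<gamma>)"
  shows "\<exists>\<gamma>'. \<not> (T \<turnstile> \<^bold>\<not> \<gamma>') \<and> (T \<turnstile> \<gamma>' \<^bold>\<longrightarrow> \<gamma>) \<and> decides T \<gamma>' (\<chi>, xs)"
proof (cases "T \<turnstile> \<^bold>\<not> (\<gamma> \<^bold>\<and> \<chi>)")
  case False
  then show ?thesis
    by (intro exI[of _ "\<gamma> \<^bold>\<and> \<chi>"]) (auto simp: decides_def intro: proves_conjD1 proves_conjD2)
next
  case True
  define \<delta> where "\<delta> = (\<gamma> \<^bold>\<and> \<^bold>\<not> \<chi>)"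
  have \<delta>: "T \<turnstile> \<delta> \<^bold>\<longrightarrow> \<gamma>" "T \<turnstile> \<delta> \<^bold>\<longrightarrow> \<^bold>\<not> \<chi>"
    unfolding \<delta>_def by (rule proves_conjD1 proves_conjD2)+
  have cons': "\<not> (T \<turnstile> \<delta> \<^bold>\<longrightarrow> \<chi>)"
  proof
    assume "T \<turnstile> \<delta> \<^bold>\<longrightarrow> \<chi>"
    then have "T \<turnstile> \<gamma> \<^bold>\<longrightarrow> \<chi>"
      using \<delta> proves_not proves_not_conj_notD unfolding \<delta>_def by blast
    then show False
      using proves_not proves_not_conjD[OF True] cons by blast
  qed
  \<comment> \<open>Adding the negation of a formula that \<open>\<delta>\<close> does not prove
    keeps consistency. Below, \<open>\<psi>\<close> is an instance of the refuted universal
    statement, or \<open>\<chi>\<close> itself if no witness is wanted.\<close>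
  have extend: "\<not> (T \<turnstile> \<^bold>\<not> (\<delta> \<^bold>\<and> \<^bold>\<not> \<psi>)) \<and> (T \<turnstile> (\<delta> \<^bold>\<and> \<^bold>\<not> \<psi>) \<^bold>\<longrightarrow> \<gamma>) \<and> (T \<turnstile> (\<delta> \<^bold>\<and> \<^bold>\<not> \<psi>) \<^bold>\<longrightarrow> \<^bold>\<not> \<chi>) \<and>
      (T \<turnstile> (\<delta> \<^bold>\<and> \<^bold>\<not> \<psi>) \<^bold>\<longrightarrow> \<^bold>\<not> \<psi>)" if "\<not> (T \<turnstile> \<delta> \<^bold>\<longrightarrow> \<psi>)" for \<psi>
    using that proves_not_conj_notD proves_conjD2 proves_imp_trans[OF proves_conjD1] \<delta> by blast
  consider (num) x \<phi> where "\<chi> = (\<^bold>\<forall>x. \<phi>)" | (set) X \<phi> where "\<chi> = (\<^bold>\<forall>\<^sub>2X. \<phi>)"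
    | (other) "\<nexists>x \<phi>. \<chi> = (\<^bold>\<forall>x. \<phi>)" "\<nexists>X \<phi>. \<chi> = (\<^bold>\<forall>\<^sub>2X. \<phi>)"
    by blast
  then show ?thesis
  proof cases
    case num
    obtain y where y: "y \<notin> set xs \<union> free_num \<delta> \<union> all_num \<phi> \<union> {x}"
      by (rule fresh_var[of "set xs \<union> free_num \<delta> \<union> all_num \<phi> \<union> {x}"]) auto
    have "\<not> (T \<turnstile> \<delta> \<^bold>\<longrightarrow> subst_num (Var y) x \<phi>)"
    proof
      assume "T \<turnstile> \<delta> \<^bold>\<longrightarrow> subst_num (Var y) x \<phi>"
      then have "T \<turnstile> \<delta> \<^bold>\<longrightarrow> (\<^bold>\<forall>y. subst_num (Var y) x \<phi>)"
        using MP[OF Distr_num Gen_num] y by blast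
      then have "T \<turnstile> \<delta> \<^bold>\<longrightarrow> \<chi>"
        using proves_rename_num proves_imp_trans y num by blast
      then show False using cons' by blast
    qed
    from extend[OF this] show ?thesis
      using num y by (intro exI) (auto simp: decides_def)
  next
    case set
    obtain Y where Y: "Y \<notin> List.set xs \<union> free_set \<delta> \<union> all_set \<phi> \<union> {X}"
      by (rule fresh_var[of "List.set xs \<union> free_set \<delta> \<union> all_set \<phi> \<union> {X}"]) auto
    have "\<not> (T \<turnstile> \<delta> \<^bold>\<longrightarrow> subst_set Y X \<phi>)"
    proof
      assume "T \<turnstile> \<delta> \<^bold>\<longrightarrow> subst_set Y X \<phi>"
      then have "T \<turnstile> \<delta> \<^bold>\<longrightarrow> (\<^bold>\<forall>\<^sub>2Y. subst_set Y X \<phi>)"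
        using MP[OF Distr_set Gen_set] Y by blast
      then have "T \<turnstile> \<delta> \<^bold>\<longrightarrow> \<chi>"
        using proves_rename_set proves_imp_trans Y set by blast
      then show False using cons' by blast
    qed
    from extend[OF this] show ?thesis
      using set Y by (intro exI) (auto simp: decides_def)
  next
    case other
    from extend[OF cons'] show ?thesis
      using other by (intro exI) (auto simp: decides_def)
  qed
qed

text \<open>Countability allows one stage per request in the construction below, and later the
  coding of classes of terms by natural numbers.\<close>

instance tm :: countable
  by countable_datatype

instance fm :: countable
  by countable_datatype

text \<open>Each stage implies the one before it and the negation of \<open>\<phi>\<close>;
  \<open>\<Gamma>\<close> collects what some stage proves. Stage n + 1 treats request number n, and
  the requests pair each formula with every list of variables, so a refuted universal statement gets
  witnesses outside every finite set.\<close>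

lemma ex_saturated:
  assumes "\<not> (T \<turnstile> \<phi>)"
  shows "\<exists>\<Gamma>. saturated T \<Gamma> \<and> \<phi> \<notin> \<Gamma>"
proof -
  have "\<exists>g. \<forall>n::nat. (\<not> (T \<turnstile> \<^bold>\<not> g n) \<and> (T \<turnstile> g n \<^bold>\<longrightarrow> \<^bold>\<not> \<phi>)) \<and>
      ((T \<turnstile> g (Suc n) \<^bold>\<longrightarrow> g n) \<and> decides T (g (Suc n)) (from_nat n))"
  proof (rule dependent_nat_choice)
    show "\<exists>\<gamma>. \<not> (T \<turnstile> \<^bold>\<not> \<gamma>) \<and> (T \<turnstile> \<gamma> \<^bold>\<longrightarrow> \<^bold>\<not> \<phi>)"
      using assms MP[OF proves_dne] proves_imp_refl by blast
  next
    fix \<gamma> and n :: nat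
    assume "\<not> (T \<turnstile> \<^bold>\<not> \<gamma>) \<and> (T \<turnstile> \<gamma> \<^bold>\<longrightarrow> \<^bold>\<not> \<phi>)"
    then show "\<exists>\<gamma>'. (\<not> (T \<turnstile> \<^bold>\<not> \<gamma>') \<and> (T \<turnstile> \<gamma>' \<^bold>\<longrightarrow> \<^bold>\<not> \<phi>)) \<and>
        ((T \<turnstile> \<gamma>' \<^bold>\<longrightarrow> \<gamma>) \<and> decides T \<gamma>' (from_nat n))"
      using consistent_decide[of T \<gamma> "fst (from_nat n)" "snd (from_nat n)"] proves_imp_trans
      by (metis prod.collapse)
  qed
  then obtain g where cons: "\<And>n. \<not> (T \<turnstile> \<^bold>\<not> g n)" and g\<phi>: "\<And>n. T \<turnstile> g n \<^bold>\<longrightarrow> \<^bold>\<not> \<phi>"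
    and step: "\<And>n. T \<turnstile> g (Suc n) \<^bold>\<longrightarrow> g n" and dec: "\<And>n. decides T (g (Suc n)) (from_nat n)"
    by blast
  have mono: "T \<turnstile> g n \<^bold>\<longrightarrow> g m" if "m \<le> n" for m n
    using that by (induction rule: dec_induct) (auto intro: proves_imp_refl proves_imp_trans step)
  have decides: "\<exists>n. decides T (g n) r" for r
    using dec[of "to_nat r"] by auto
  define \<Gamma> where "\<Gamma> = {\<psi>. \<exists>n. (T \<turnstile> g n \<^bold>\<longrightarrow> \<psi>)}"
  have join: "\<exists>n. (T \<turnstile> g n \<^bold>\<longrightarrow> \<psi>) \<and> (T \<turnstile> g n \<^bold>\<longrightarrow> \<chi>)" if "\<psi> \<in> \<Gamma>" "\<chi> \<in> \<Gamma>" for \<psi> \<chi>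
    using that mono proves_imp_trans unfolding \<Gamma>_def mem_Collect_eq by (metis nle_le)
  have not_both: "(\<^bold>\<not> \<psi>) \<in> \<Gamma> \<Longrightarrow> \<psi> \<notin> \<Gamma>" for \<psi>
    using join proves_not cons by blast
  have "saturated T \<Gamma>"
  proof
    show "\<psi> \<in> \<Gamma>" if "T \<turnstile> \<psi>" for \<psi>
      using that proves_weaken by (auto simp: \<Gamma>_def)
    show "\<chi> \<in> \<Gamma>" if "(\<psi> \<^bold>\<longrightarrow> \<chi>) \<in> \<Gamma>" "\<psi> \<in> \<Gamma>" for \<psi> \<chi>
      using join[OF that] proves_imp_mp unfolding \<Gamma>_def mem_Collect_eq by blast
    show "(\<^bold>\<not> \<psi>) \<in> \<Gamma> \<longleftrightarrow> \<psi> \<notin> \<Gamma>" for \<psi>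
      using not_both decides[of "(\<psi>, [])"] by (auto simp: \<Gamma>_def decides_def)
    show "\<exists>y. y \<notin> A \<and> subst_num (Var y) x \<psi> \<notin> \<Gamma>" if fin: "finite A" and notin: "(\<^bold>\<forall>x. \<psi>) \<notin> \<Gamma>" for A x \<psi>
    proof -
      obtain xs where "set xs = A" using finite_list[OF fin] by blast
      then show ?thesis
        using not_both decides[of "(\<^bold>\<forall>x. \<psi>, xs)"] notin
        by (fastforce simp: \<Gamma>_def decides_def)
    qed
    show "\<exists>Y. Y \<notin> A \<and> subst_set Y X \<psi> \<notin> \<Gamma>" if fin: "finite A" and notin: "(\<^bold>\<forall>\<^sub>2X. \<psi>) \<notin> \<Gamma>" for A X \<psi>
    proof -
      obtain xs where "set xs = A" using finite_list[OF fin] by blast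
      then show ?thesis
        using not_both decides[of "(\<^bold>\<forall>\<^sub>2X. \<psi>, xs)"] notin
        by (fastforce simp: \<Gamma>_def decides_def)
    qed
  qed
  moreover have "\<phi> \<notin> \<Gamma>"
    using not_both[of \<phi>] g\<phi> by (auto simp: \<Gamma>_def)
  ultimately show ?thesis by blast
qed

section \<open>Structures and completeness\<close>

text \<open>\<open>Me\<close> is an arbitrary relation, so distinct objects of the set sort may have
  the same members; the language cannot tell them apart.\<close>

record ('n, 's) struct =
  Zr :: 'n
  On :: 'n
  Pl :: "'n \<Rightarrow> 'n \<Rightarrow> 'n"
  Tm :: "'n \<Rightarrow> 'n \<Rightarrow> 'n"
  Ls :: "'n \<Rightarrow> 'n \<Rightarrow> bool"
  Me :: "'n \<Rightarrow> 's \<Rightarrow> bool"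

primrec tm_val :: "('n, 's) struct \<Rightarrow> (var \<Rightarrow> 'n) \<Rightarrow> tm \<Rightarrow> 'n" where
  "tm_val M e (Var x) = e x"
| "tm_val M e \<^bold>0 = Zr M"
| "tm_val M e \<^bold>1 = On M"
| "tm_val M e (s \<^bold>+ t) = Pl M (tm_val M e s) (tm_val M e t)"
| "tm_val M e (s \<^bold>* t) = Tm M (tm_val M e s) (tm_val M e t)"

primrec sat :: "('n, 's) struct \<Rightarrow> (var \<Rightarrow> 'n) \<Rightarrow> (var \<Rightarrow> 's) \<Rightarrow> fm \<Rightarrow> bool" where
  "sat M e f (s \<^bold>= t) \<longleftrightarrow> tm_val M e s = tm_val M e t"
| "sat M e f (s \<^bold>< t) \<longleftrightarrow> Ls M (tm_val M e s) (tm_val M e t)"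
| "sat M e f (t \<^bold>\<in> X) \<longleftrightarrow> Me M (tm_val M e t) (f X)"
| "sat M e f (\<^bold>\<not> \<phi>) \<longleftrightarrow> \<not> sat M e f \<phi>"
| "sat M e f (\<phi> \<^bold>\<longrightarrow> \<psi>) \<longleftrightarrow> (sat M e f \<phi> \<longrightarrow> sat M e f \<psi>)"
| "sat M e f (\<^bold>\<forall>x. \<phi>) \<longleftrightarrow> (\<forall>d. sat M (e(x := d)) f \<phi>)"
| "sat M e f (\<^bold>\<forall>\<^sub>2X. \<phi>) \<longleftrightarrow> (\<forall>D. sat M e (f(X := D)) \<phi>)"

lemma tm_val_cong: "(\<And>x. x \<in> vars_tm t \<Longrightarrow> e x = e' x) \<Longrightarrow> tm_val M e t = tm_val M e' t"
  by (induction t) auto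

lemma sat_cong:
  "(\<And>x. x \<in> free_num \<phi> \<Longrightarrow> e x = e' x) \<Longrightarrow> (\<And>X. X \<in> free_set \<phi> \<Longrightarrow> f X = f' X) \<Longrightarrow>
    sat M e f \<phi> \<longleftrightarrow> sat M e' f' \<phi>"
proof (induction \<phi> arbitrary: e e' f f')
  case (Eq s t)
  then show ?case using tm_val_cong[of s e e' M] tm_val_cong[of t e e' M] by simp
next
  case (Less s t)
  then show ?case using tm_val_cong[of s e e' M] tm_val_cong[of t e e' M] by simp
next
  case (Mem t X)
  then show ?case using tm_val_cong[of t e e' M] by simp
next
  case (Neg \<phi>)
  show ?case using Neg.IH[of e e' f f'] Neg.prems by simp
next
  case (Imp \<phi> \<psi>)
  show ?case using Imp.IH(1)[of e e' f f'] Imp.IH(2)[of e e' f f'] Imp.prems by simp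
next
  case (AllN x \<phi>)
  have "sat M (e(x := d)) f \<phi> \<longleftrightarrow> sat M (e'(x := d)) f' \<phi>" for d
    by (rule AllN.IH) (use AllN.prems in auto)
  then show ?case by simp
next
  case (AllS X \<phi>)
  have "sat M e (f(X := D)) \<phi> \<longleftrightarrow> sat M e' (f'(X := D)) \<phi>" for D
    by (rule AllS.IH) (use AllS.prems in auto)
  then show ?case by simp
qed

text \<open>Formulas see a set only through its members. This permits replacing a set of the term
  model by a coextensive one with a fresh name.\<close>

lemma sat_coext:
  "(\<And>X a. Me M a (f X) \<longleftrightarrow> Me M a (f' X)) \<Longrightarrow> sat M e f \<phi> \<longleftrightarrow> sat M e f' \<phi>"
proof (induction \<phi> arbitrary: e f f')
  case (Neg \<phi>)
  show ?case using Neg.IH[of f f' e] Neg.prems by simp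
next
  case (Imp \<phi> \<psi>)
  show ?case using Imp.IH(1)[of f f' e] Imp.IH(2)[of f f' e] Imp.prems by simp
next
  case (AllN x \<phi>)
  have "sat M (e(x := d)) f \<phi> \<longleftrightarrow> sat M (e(x := d)) f' \<phi>" for d
    by (rule AllN.IH) (rule AllN.prems)
  then show ?case by simp
next
  case (AllS X \<phi>)
  have "sat M e (f(X := D)) \<phi> \<longleftrightarrow> sat M e (f'(X := D)) \<phi>" for D
    by (rule AllS.IH) (use AllS.prems in auto)
  then show ?case by simp
qed auto

lemma tm_val_subst: "tm_val M e (subst_tm t x s) = tm_val M (e(x := tm_val M e t)) s"
  by (induction s) auto

lemma sat_subst_num:
  "num_free_for t x \<phi> \<Longrightarrow> sat M e f (subst_num t x \<phi>) \<longleftrightarrow> sat M (e(x := tm_val M e t)) f \<phi>"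
proof (induction \<phi> arbitrary: e f)
  case (AllN y \<phi>)
  show ?case
  proof (cases "x \<in> free_num (\<^bold>\<forall>y. \<phi>)")
    case True
    then have "tm_val M (e(y := d)) t = tm_val M e t" for d
      using AllN.prems by (intro tm_val_cong) auto
    moreover have "x \<noteq> y" "num_free_for t x \<phi>"
      using True AllN.prems by auto
    ultimately have "sat M (e(y := d)) f (subst_num t x \<phi>) \<longleftrightarrow> sat M (e(x := tm_val M e t, y := d)) f \<phi>" for d
      by (metis AllN.IH fun_upd_twist)
    moreover have "subst_num t x (\<^bold>\<forall>y. \<phi>) = (\<^bold>\<forall>y. subst_num t x \<phi>)"
      using \<open>x \<noteq> y\<close> by simp
    ultimately show ?thesis by (simp only: sat.simps)
  next
    case False
    have "sat M e f (\<^bold>\<forall>y. \<phi>) \<longleftrightarrow> sat M (e(x := tm_val M e t)) f (\<^bold>\<forall>y. \<phi>)"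
      by (rule sat_cong) (use False in auto)
    \<comment> \<open>\<open>subst_num_fresh\<close> does not apply here, since \<open>x\<close> may
      still occur bound.\<close>
    moreover have "x \<notin> free_num \<psi> \<Longrightarrow> subst_num t x \<psi> = \<psi>" for \<psi>
      by (induction \<psi>) auto
    then have "subst_num t x (\<^bold>\<forall>y. \<phi>) = (\<^bold>\<forall>y. \<phi>)"
      using False by blast
    ultimately show ?thesis by (simp only:)
  qed
qed (auto simp: tm_val_subst)

lemma sat_subst_set:
  "set_free_for Y X \<phi> \<Longrightarrow> sat M e f (subst_set Y X \<phi>) \<longleftrightarrow> sat M e (f(X := f Y)) \<phi>"
proof (induction \<phi> arbitrary: e f)
  case (AllS Z \<phi>)
  show ?case
  proof (cases "X \<in> free_set (\<^bold>\<forall>\<^sub>2Z. \<phi>)")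
    case True
    then have "X \<noteq> Z" "Z \<noteq> Y" "set_free_for Y X \<phi>"
      using AllS.prems by auto
    then have "sat M e (f(Z := D)) (subst_set Y X \<phi>) \<longleftrightarrow> sat M e (f(X := f Y, Z := D)) \<phi>" for D
      by (metis AllS.IH fun_upd_twist fun_upd_other)
    moreover have "subst_set Y X (\<^bold>\<forall>\<^sub>2Z. \<phi>) = (\<^bold>\<forall>\<^sub>2Z. subst_set Y X \<phi>)"
      using \<open>X \<noteq> Z\<close> by simp
    ultimately show ?thesis by (simp only: sat.simps)
  next
    case False
    have "sat M e f (\<^bold>\<forall>\<^sub>2Z. \<phi>) \<longleftrightarrow> sat M e (f(X := f Y)) (\<^bold>\<forall>\<^sub>2Z. \<phi>)"
      by (rule sat_cong) (use False in auto)
    moreover have "X \<notin> free_set \<psi> \<Longrightarrow> subst_set Y X \<psi> = \<psi>" for \<psi>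
      by (induction \<psi>) auto
    then have "subst_set Y X (\<^bold>\<forall>\<^sub>2Z. \<phi>) = (\<^bold>\<forall>\<^sub>2Z. \<phi>)"
      using False by blast
    ultimately show ?thesis by (simp only:)
  qed
qed auto

section \<open>The term model of a saturated set\<close>

primrec num :: "nat \<Rightarrow> tm" where
  "num 0 = \<^bold>0"
| "num (Suc n) = num n \<^bold>+ \<^bold>1"

text \<open>Measure for the truth lemma: its quantifier cases pass to substitution instances, which
  are not subformulas but have the depth of the body.\<close>

primrec depth :: "fm \<Rightarrow> nat" where
  "depth (s \<^bold>= t) = 0"
| "depth (s \<^bold>< t) = 0"
| "depth (t \<^bold>\<in> X) = 0"
| "depth (\<^bold>\<not> \<phi>) = Suc (depth \<phi>)"
| "depth (\<phi> \<^bold>\<longrightarrow> \<psi>) = Suc (depth \<phi> + depth \<psi>)"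
| "depth (\<^bold>\<forall>x. \<phi>) = Suc (depth \<phi>)"
| "depth (\<^bold>\<forall>\<^sub>2X. \<phi>) = Suc (depth \<phi>)"

lemma depth_subst [simp]:
  "depth (subst_num t x \<phi>) = depth \<phi>" "depth (subst_set Y X \<phi>) = depth \<phi>"
  by (induction \<phi>) auto

context saturated
begin

lemma imp_iff: "(\<phi> \<^bold>\<longrightarrow> \<psi>) \<in> \<Gamma> \<longleftrightarrow> (\<phi> \<in> \<Gamma> \<longrightarrow> \<psi> \<in> \<Gamma>)"
  using mp provable[OF proves_ex_falso] provable[OF K] neg_iff by blast

lemma leibniz:
  "(s \<^bold>= t) \<in> \<Gamma> \<Longrightarrow> num_free_for s x \<phi> \<Longrightarrow> num_free_for t x \<phi> \<Longrightarrow> subst_num s x \<phi> \<in> \<Gamma> \<Longrightarrow>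
    subst_num t x \<phi> \<in> \<Gamma>"
  using provable[OF Leibniz] mp by blast

lemma inst_num: "(\<^bold>\<forall>x. \<phi>) \<in> \<Gamma> \<Longrightarrow> num_free_for t x \<phi> \<Longrightarrow> subst_num t x \<phi> \<in> \<Gamma>"
  using provable[OF Inst_num] mp by blast

lemma inst_set: "(\<^bold>\<forall>\<^sub>2X. \<phi>) \<in> \<Gamma> \<Longrightarrow> set_free_for Y X \<phi> \<Longrightarrow> subst_set Y X \<phi> \<in> \<Gamma>"
  using provable[OF Inst_set] mp by blast

lemma eq_refl: "(t \<^bold>= t) \<in> \<Gamma>"
  using provable[OF Refl] .

lemma eq_sym: "(s \<^bold>= t) \<in> \<Gamma> \<Longrightarrow> (t \<^bold>= s) \<in> \<Gamma>"
proof -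
  assume st: "(s \<^bold>= t) \<in> \<Gamma>"
  obtain x where "x \<notin> vars_tm s" by (rule fresh_var[OF finite_vars_tm])
  then show ?thesis using leibniz[OF st, of x "Var x \<^bold>= s"] eq_refl by simp
qed

lemma eq_trans: "(s \<^bold>= t) \<in> \<Gamma> \<Longrightarrow> (t \<^bold>= u) \<in> \<Gamma> \<Longrightarrow> (s \<^bold>= u) \<in> \<Gamma>"
proof -
  assume st: "(s \<^bold>= t) \<in> \<Gamma>" and tu: "(t \<^bold>= u) \<in> \<Gamma>"
  obtain x where "x \<notin> vars_tm s" by (rule fresh_var[OF finite_vars_tm])
  then show ?thesis using leibniz[OF tu, of x "s \<^bold>= Var x"] st by simp
qed

text \<open>\<open>Leibniz\<close> exchanges terms for one variable at a time, so the two arguments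
  are replaced in turn. The context is a function of two terms, and \<open>r\<close> carries its
  further terms, whose variables the placeholder \<open>x\<close> must avoid.\<close>

lemma eq_cong2:
  assumes ss': "(s \<^bold>= s') \<in> \<Gamma>" and tt': "(t \<^bold>= t') \<in> \<Gamma>"
    and step: "\<And>x s. x \<notin> vars_tm t \<union> vars_tm t' \<union> vars_tm s' \<union> vars_tm r \<Longrightarrow>
      num_free_for s x (\<phi> (Var x) t) \<and> num_free_for s x (\<phi> s' (Var x)) \<and>
      subst_num s x (\<phi> (Var x) t) = \<phi> s t \<and> subst_num s x (\<phi> s' (Var x)) = \<phi> s' s"
    and 1: "\<phi> s t \<in> \<Gamma>"
  shows "\<phi> s' t' \<in> \<Gamma>"
proof -
  obtain x where x: "x \<notin> vars_tm t \<union> vars_tm t' \<union> vars_tm s' \<union> vars_tm r"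
    by (rule fresh_var[of "vars_tm t \<union> vars_tm t' \<union> vars_tm s' \<union> vars_tm r"]) auto
  have "\<phi> s' t \<in> \<Gamma>"
    using leibniz[OF ss', of x "\<phi> (Var x) t"] step[OF x] 1 by simp
  then show ?thesis
    using leibniz[OF tt', of x "\<phi> s' (Var x)"] step[OF x] by simp
qed

lemma add_cong: "(s \<^bold>= s') \<in> \<Gamma> \<Longrightarrow> (t \<^bold>= t') \<in> \<Gamma> \<Longrightarrow> (s \<^bold>+ t \<^bold>= s' \<^bold>+ t') \<in> \<Gamma>"
  using eq_cong2[of s s' t t' "s \<^bold>+ t" "\<lambda>a b. s \<^bold>+ t \<^bold>= a \<^bold>+ b"] eq_refl by simp

lemma mult_cong: "(s \<^bold>= s') \<in> \<Gamma> \<Longrightarrow> (t \<^bold>= t') \<in> \<Gamma> \<Longrightarrow> (s \<^bold>* t \<^bold>= s' \<^bold>* t') \<in> \<Gamma>"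
  using eq_cong2[of s s' t t' "s \<^bold>* t" "\<lambda>a b. s \<^bold>* t \<^bold>= a \<^bold>* b"] eq_refl by simp

lemma less_cong: "(s \<^bold>= s') \<in> \<Gamma> \<Longrightarrow> (t \<^bold>= t') \<in> \<Gamma> \<Longrightarrow> (s \<^bold>< t) \<in> \<Gamma> \<Longrightarrow> (s' \<^bold>< t') \<in> \<Gamma>"
  using eq_cong2[of s s' t t' "\<^bold>0" "\<lambda>a b. a \<^bold>< b"] by simp

lemma mem_cong: "(s \<^bold>= s') \<in> \<Gamma> \<Longrightarrow> (s \<^bold>\<in> X) \<in> \<Gamma> \<Longrightarrow> (s' \<^bold>\<in> X) \<in> \<Gamma>"
  using leibniz[of s s' "''x''" "Var ''x'' \<^bold>\<in> X"] by simp

text \<open>Substituting an arbitrary term may lead to capture; a variable equal to it and outside a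
  suitable \<open>A\<close> is safe. That some object equals \<open>t\<close> is verified by
  \<open>t\<close> itself, and the witness to this is the desired variable.\<close>

lemma fresh_name_num:
  assumes "finite A"
  shows "\<exists>y. y \<notin> A \<and> (Var y \<^bold>= t) \<in> \<Gamma>"
proof -
  obtain x where x: "x \<notin> vars_tm t" by (rule fresh_var[OF finite_vars_tm])
  have "(\<^bold>\<forall>x. \<^bold>\<not> Var x \<^bold>= t) \<notin> \<Gamma>"
    using inst_num[of x "\<^bold>\<not> Var x \<^bold>= t" t] x neg_iff eq_refl by auto
  from witness_num[OF assms this] show ?thesis
    using x neg_iff by auto
qed

text \<open>A name of \<open>Y\<close> can only mean a set with the same members. \<open>Y\<close>
  itself shows that there is such a set, and saturation turns this into a witness outside
  \<open>A\<close>.\<close>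

lemma fresh_name_set:
  assumes "finite A"
  shows "\<exists>Z. Z \<notin> A \<and> (\<forall>t. (t \<^bold>\<in> Z) \<in> \<Gamma> \<longleftrightarrow> (t \<^bold>\<in> Y) \<in> \<Gamma>)"
proof -
  obtain X where X: "X \<notin> {Y}" by (rule fresh_var[of "{Y}"]) auto
  let ?\<phi> = "\<lambda>X. \<^bold>\<forall>''x''. Var ''x'' \<^bold>\<in> X \<^bold>\<longleftrightarrow> Var ''x'' \<^bold>\<in> Y"
  have "T \<turnstile> ?\<phi> Y"
    by (rule Gen_num[OF proves_conjI[OF proves_imp_refl proves_imp_refl]])
  then have "(\<^bold>\<forall>\<^sub>2X. \<^bold>\<not> ?\<phi> X) \<notin> \<Gamma>"
    using inst_set[of X "\<^bold>\<not> ?\<phi> X" Y] X neg_iff provable by auto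
  from witness_set[OF assms this] obtain Z where Z: "Z \<notin> A" "?\<phi> Z \<in> \<Gamma>"
    using X neg_iff by auto
  show ?thesis
    using Z(1) inst_num[OF Z(2)] neg_iff imp_iff by (intro exI[of _ Z]) auto
qed

text \<open>The numbers are the classes of terms modulo the equations in \<open>\<Gamma>\<close>,
  numbered by \<open>v\<close>, with \<open>r\<close> choosing representatives; the sets are the set
  variables themselves. Under the assignment in which every variable names itself, truth is
  membership in \<open>\<Gamma>\<close>.\<close>

lemma ex_model:
  assumes numerals: "\<And>i j. i \<noteq> j \<Longrightarrow> (num i \<^bold>= num j) \<notin> \<Gamma>"
  shows "\<exists>(M :: (nat, var) struct) e f. \<forall>\<phi>. sat M e f \<phi> \<longleftrightarrow> \<phi> \<in> \<Gamma>"
proof -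
  define cls where "cls t = {s. (s \<^bold>= t) \<in> \<Gamma>}" for t
  have cls_eq: "cls s = cls t \<longleftrightarrow> (s \<^bold>= t) \<in> \<Gamma>" for s t
    unfolding cls_def using eq_refl eq_sym eq_trans by blast
  have "inj (cls \<circ> num)"
    using numerals cls_eq by (auto simp: inj_def)
  then have "infinite (range (cls \<circ> num))"
    using finite_imageD infinite_UNIV_nat by blast
  then have inf: "infinite (range cls)"
    by (metis image_comp image_mono subset_UNIV finite_subset)
  define v where "v t = to_nat_on (range cls) (cls t)" for t
  have "countable (range cls)"
    by (intro countable_image countableI_type)
  then have v_eq: "v s = v t \<longleftrightarrow> (s \<^bold>= t) \<in> \<Gamma>" for s t
    unfolding v_def cls_eq[symmetric] by (simp add: to_nat_on_inj)
  have "range v = to_nat_on (range cls) ` range cls"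
    by (auto simp: v_def)
  then have surj_v: "surj v"
    using to_nat_on_infinite[of "range cls"] inf by (simp add: bij_betw_def)
  define r where "r = inv v"
  have v_r: "v (r a) = a" for a
    using surj_v by (simp add: r_def surj_f_inv_f)
  then have r_v: "(r (v t) \<^bold>= t) \<in> \<Gamma>" for t
    using v_eq by blast
  define M :: "(nat, var) struct" where
    "M = \<lparr>Zr = v \<^bold>0, On = v \<^bold>1, Pl = (\<lambda>a b. v (r a \<^bold>+ r b)), Tm = (\<lambda>a b. v (r a \<^bold>* r b)),
      Ls = (\<lambda>a b. (r a \<^bold>< r b) \<in> \<Gamma>), Me = (\<lambda>a X. (r a \<^bold>\<in> X) \<in> \<Gamma>)\<rparr>"
  have Ls_M: "Ls M a b \<longleftrightarrow> (r a \<^bold>< r b) \<in> \<Gamma>" for a b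
    by (simp add: M_def)
  have Me_M: "Me M a X \<longleftrightarrow> (r a \<^bold>\<in> X) \<in> \<Gamma>" for a X
    by (simp add: M_def)
  let ?e = "\<lambda>x. v (Var x)"
  let ?f = "\<lambda>X. X"
  have val: "tm_val M ?e t = v t" for t
    by (induction t) (auto simp: M_def v_eq r_v intro: add_cong mult_cong)
  have "sat M ?e ?f \<phi> \<longleftrightarrow> \<phi> \<in> \<Gamma>" for \<phi>
  proof (induction "depth \<phi>" arbitrary: \<phi> rule: less_induct)
    case less
    show ?case
    proof (cases \<phi>)
      case (Eq s t)
      then show ?thesis by (simp add: val v_eq)
    next
      case (Less s t)
      have "(r (v s) \<^bold>< r (v t)) \<in> \<Gamma> \<longleftrightarrow> (s \<^bold>< t) \<in> \<Gamma>"
        by (rule iffI) (erule less_cong[rotated 2]; rule r_v eq_sym[OF r_v])+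
      with Less show ?thesis by (simp add: val Ls_M)
    next
      case (Mem t X)
      have "(r (v t) \<^bold>\<in> X) \<in> \<Gamma> \<longleftrightarrow> (t \<^bold>\<in> X) \<in> \<Gamma>"
        by (rule iffI) (erule mem_cong[rotated]; rule r_v eq_sym[OF r_v])+
      with Mem show ?thesis by (simp add: val Me_M)
    next
      case (Neg \<psi>)
      then show ?thesis using less[of \<psi>] neg_iff by simp
    next
      case (Imp \<psi> \<chi>)
      then show ?thesis using less[of \<psi>] less[of \<chi>] imp_iff by simp
    next
      case (AllN x \<psi>)
      have IH: "sat M (?e(x := v t)) ?f \<psi> \<longleftrightarrow> subst_num t x \<psi> \<in> \<Gamma>" if "num_free_for t x \<psi>" for t
        using less[of "subst_num t x \<psi>"] sat_subst_num[OF that, of M ?e ?f] AllN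
        by (simp add: val)
      show ?thesis
      proof
        assume "sat M ?e ?f \<phi>"
        show "\<phi> \<in> \<Gamma>"
        proof (rule ccontr)
          assume "\<phi> \<notin> \<Gamma>"
          then obtain y where "y \<notin> all_num \<psi>" "subst_num (Var y) x \<psi> \<notin> \<Gamma>"
            using witness_num[of "all_num \<psi>" x \<psi>] AllN by auto
          then show False
            using IH[of "Var y"] num_free_for_fresh \<open>sat M ?e ?f \<phi>\<close> AllN by auto
        qed
      next
        assume "\<phi> \<in> \<Gamma>"
        have "sat M (?e(x := d)) ?f \<psi>" for d
        proof -
          obtain y where y: "y \<notin> all_num \<psi>" "(Var y \<^bold>= r d) \<in> \<Gamma>"
            using fresh_name_num[of "all_num \<psi>"] by auto
          then have "d = v (Var y)"
            using v_eq v_r by metis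
          moreover have "subst_num (Var y) x \<psi> \<in> \<Gamma>"
            using inst_num num_free_for_fresh y \<open>\<phi> \<in> \<Gamma>\<close> AllN by blast
          ultimately show ?thesis
            using IH[of "Var y"] num_free_for_fresh y by blast
        qed
        then show "sat M ?e ?f \<phi>" using AllN by simp
      qed
    next
      case (AllS X \<psi>)
      have IH: "sat M ?e (?f(X := Y)) \<psi> \<longleftrightarrow> subst_set Y X \<psi> \<in> \<Gamma>" if "set_free_for Y X \<psi>" for Y
        using less[of "subst_set Y X \<psi>"] sat_subst_set[OF that, of M ?e ?f] AllS by simp
      show ?thesis
      proof
        assume "sat M ?e ?f \<phi>"
        show "\<phi> \<in> \<Gamma>"
        proof (rule ccontr)
          assume "\<phi> \<notin> \<Gamma>"
          then obtain Y where "Y \<notin> all_set \<psi>" "subst_set Y X \<psi> \<notin> \<Gamma>"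
            using witness_set[of "all_set \<psi>" X \<psi>] AllS by auto
          then show False
            using IH[of Y] set_free_for_fresh \<open>sat M ?e ?f \<phi>\<close> AllS by auto
        qed
      next
        assume "\<phi> \<in> \<Gamma>"
        have "sat M ?e (?f(X := Y)) \<psi>" for Y
        proof -
          obtain Z where Z: "Z \<notin> all_set \<psi>" "\<And>t. (t \<^bold>\<in> Z) \<in> \<Gamma> \<longleftrightarrow> (t \<^bold>\<in> Y) \<in> \<Gamma>"
            using fresh_name_set[OF finite_all_set] by blast
          have "sat M ?e (?f(X := Z)) \<psi>"
            using IH[of Z] inst_set set_free_for_fresh Z(1) \<open>\<phi> \<in> \<Gamma>\<close> AllS by blast
          then show ?thesis
            using Z(2) by (subst sat_coext[where f' = "?f(X := Z)"]) (auto simp: Me_M)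
        qed
        then show "sat M ?e ?f \<phi>" using AllS by simp
      qed
    qed
  qed
  then show ?thesis by blast
qed

end

text \<open>The term model is known to satisfy \<open>\<Gamma>\<close> under one assignment only,
  whereas axioms must hold under all of them. Closing an axiom universally before passing to the
  model bridges this gap.\<close>

lemma proves_foldr_AllN: "T \<turnstile> \<phi> \<Longrightarrow> T \<turnstile> foldr AllN xs \<phi>"
  by (induction xs) (auto intro: Gen_num)

lemma proves_foldr_AllS: "T \<turnstile> \<phi> \<Longrightarrow> T \<turnstile> foldr AllS xs \<phi>"
  by (induction xs) (auto intro: Gen_set)

lemma sat_foldr_AllN:
  "sat M e f (foldr AllN xs \<phi>) \<Longrightarrow> (\<And>x. x \<notin> set xs \<Longrightarrow> e' x = e x) \<Longrightarrow> sat M e' f \<phi>"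
proof (induction xs arbitrary: e)
  case Nil
  then have "e' = e" by auto
  with Nil show ?case by simp
next
  case (Cons x xs)
  then have "sat M (e(x := e' x)) f (foldr AllN xs \<phi>)" by simp
  then show ?case by (rule Cons.IH) (use Cons.prems in auto)
qed

lemma sat_foldr_AllS:
  "sat M e f (foldr AllS xs \<phi>) \<Longrightarrow> (\<And>x. x \<notin> set xs \<Longrightarrow> f' x = f x) \<Longrightarrow> sat M e f' \<phi>"
proof (induction xs arbitrary: f)
  case Nil
  then have "f' = f" by auto
  with Nil show ?case by simp
next
  case (Cons x xs)
  then have "sat M e (f(x := f' x)) (foldr AllS xs \<phi>)" by simp
  then show ?case by (rule Cons.IH) (use Cons.prems in auto)
qed

text \<open>The numerals are required to be distinct so that the Henkin model, whose elements are classes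
  of terms, is countably infinite and can be transported to the type of natural numbers.\<close>
theorem completeness:
  assumes numerals: "\<And>i j. i \<noteq> j \<Longrightarrow> T \<turnstile> \<^bold>\<not> num i \<^bold>= num j"
    and valid: "\<And>(M :: (nat, var) struct) e f. (\<And>\<psi> e f. \<psi> \<in> T \<Longrightarrow> sat M e f \<psi>) \<Longrightarrow> sat M e f \<phi>"
  shows "T \<turnstile> \<phi>"
proof (rule ccontr)
  assume "\<not> (T \<turnstile> \<phi>)"
  then obtain \<Gamma> where \<Gamma>: "saturated T \<Gamma>" "\<phi> \<notin> \<Gamma>"
    using ex_saturated by blast
  then interpret saturated T \<Gamma> by simp
  obtain M :: "(nat, var) struct" and e f where M: "\<And>\<phi>. sat M e f \<phi> \<longleftrightarrow> \<phi> \<in> \<Gamma>"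
    using ex_model provable[OF numerals] neg_iff by metis
  have "sat M e' f' \<psi>" if "\<psi> \<in> T" for \<psi> e' f'
  proof -
    obtain xs where xs: "set xs = free_num \<psi>" using finite_list[OF finite_free_num] by blast
    obtain Xs where Xs: "set Xs = free_set \<psi>" using finite_list[OF finite_free_set] by blast
    let ?e = "\<lambda>x. if x \<in> set xs then e' x else e x"
    let ?f = "\<lambda>X. if X \<in> set Xs then f' X else f X"
    have "sat M e f (foldr AllN xs (foldr AllS Xs \<psi>))"
      using provable proves_foldr_AllN proves_foldr_AllS Axiom[OF that] M by blast
    then have "sat M ?e f (foldr AllS Xs \<psi>)"
      by (rule sat_foldr_AllN) simp
    then have "sat M ?e ?f \<psi>"
      by (rule sat_foldr_AllS) simp
    then show ?thesis
      by (rule sat_cong[THEN iffD1, rotated 2]) (auto simp: xs Xs)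
  qed
  then have "sat M e f \<phi>" by (rule valid)
  then show False using M \<Gamma> by blast
qed

section \<open>Arithmetic in models of RCA0\<close>

lemma num_free_for_closed: "vars_tm t = {} \<Longrightarrow> num_free_for t x \<phi>"
  by (induction \<phi>) auto

locale rca0_model =
  fixes M :: "('n, 's) struct"
  assumes model: "\<phi> \<in> RCA0 \<Longrightarrow> sat M e f \<phi>"
begin

abbreviation zero :: 'n ("\<zero>") where "\<zero> \<equiv> Zr M"
abbreviation one :: 'n ("\<one>") where "\<one> \<equiv> On M"
abbreviation add (infixl "\<oplus>" 65) where "a \<oplus> b \<equiv> Pl M a b"
abbreviation mult (infixl "\<otimes>" 70) where "a \<otimes> b \<equiv> Tm M a b"
abbreviation lt (infix "\<prec>" 50) where "a \<prec> b \<equiv> Ls M a b"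
abbreviation elem (infix "\<epsilon>" 50) where "a \<epsilon> X \<equiv> Me M a X"
abbreviation pr :: "'n \<Rightarrow> 'n \<Rightarrow> 'n" where "pr a b \<equiv> (a \<oplus> b) \<otimes> (a \<oplus> b) \<oplus> a"

text \<open>The basic axioms mention only the variables \<open>m\<close> and \<open>n\<close>; the
  default value \<open>b\<close> is the value of \<open>n\<close>.\<close>

lemma basic: "\<phi> \<in> basic_axioms \<Longrightarrow> sat M ((\<lambda>_. b)(''m'' := a)) f \<phi>"
  by (rule model) (simp add: RCA0_def)

lemma
  shows suc_neq_zero: "b \<oplus> \<one> \<noteq> \<zero>"
    and suc_inject: "a \<oplus> \<one> = b \<oplus> \<one> \<Longrightarrow> a = b"
    and add_zero: "a \<oplus> \<zero> = a"
    and add_suc: "a \<oplus> (b \<oplus> \<one>) = (a \<oplus> b) \<oplus> \<one>"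
    and mult_zero: "a \<otimes> \<zero> = \<zero>"
    and mult_suc: "a \<otimes> (b \<oplus> \<one>) = (a \<otimes> b) \<oplus> a"
    and not_less_zero: "\<not> a \<prec> \<zero>"
    and less_suc: "a \<prec> b \<oplus> \<one> \<longleftrightarrow> a \<prec> b \<or> a = b"
proof -
  let ?m = "Var ''m''" and ?n = "Var ''n''"
  note * = basic[of _ b a "\<lambda>_. undefined", unfolded basic_axioms_def Let_def]
  show "b \<oplus> \<one> \<noteq> \<zero>"
    using *[of "\<^bold>\<not> (?n \<^bold>+ \<^bold>1 \<^bold>= \<^bold>0)"] by simp
  show "a \<oplus> \<one> = b \<oplus> \<one> \<Longrightarrow> a = b"
    using *[of "?m \<^bold>+ \<^bold>1 \<^bold>= ?n \<^bold>+ \<^bold>1 \<^bold>\<longrightarrow> ?m \<^bold>= ?n"] by simp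
  show "a \<oplus> \<zero> = a"
    using *[of "?m \<^bold>+ \<^bold>0 \<^bold>= ?m"] by simp
  show "a \<oplus> (b \<oplus> \<one>) = (a \<oplus> b) \<oplus> \<one>"
    using *[of "?m \<^bold>+ (?n \<^bold>+ \<^bold>1) \<^bold>= (?m \<^bold>+ ?n) \<^bold>+ \<^bold>1"] by simp
  show "a \<otimes> \<zero> = \<zero>"
    using *[of "?m \<^bold>* \<^bold>0 \<^bold>= \<^bold>0"] by simp
  show "a \<otimes> (b \<oplus> \<one>) = (a \<otimes> b) \<oplus> a"
    using *[of "?m \<^bold>* (?n \<^bold>+ \<^bold>1) \<^bold>= (?m \<^bold>* ?n) \<^bold>+ ?m"] by simp
  show "\<not> a \<prec> \<zero>"
    using *[of "\<^bold>\<not> (?m \<^bold>< \<^bold>0)"] by simp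
  show "a \<prec> b \<oplus> \<one> \<longleftrightarrow> a \<prec> b \<or> a = b"
    using *[of "?m \<^bold>< ?n \<^bold>+ \<^bold>1 \<^bold>\<longleftrightarrow> (?m \<^bold>< ?n \<^bold>\<or> ?m \<^bold>= ?n)"] by simp blast
qed

section \<open>Induction and comprehension as properties of the model\<close>

lemma sigma_induct:
  assumes "bounded \<theta>" "num_free_for (Var x \<^bold>+ \<^bold>1) x (\<^bold>\<exists>y. \<theta>)"
    and "sat M (e(x := \<zero>)) f (\<^bold>\<exists>y. \<theta>)"
    and "\<And>a. sat M (e(x := a)) f (\<^bold>\<exists>y. \<theta>) \<Longrightarrow> sat M (e(x := a \<oplus> \<one>)) f (\<^bold>\<exists>y. \<theta>)"
  shows "sat M (e(x := a)) f (\<^bold>\<exists>y. \<theta>)"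
proof -
  let ?\<phi> = "\<^bold>\<exists>y. \<theta>"
  have "(subst_num \<^bold>0 x ?\<phi> \<^bold>\<and> (\<^bold>\<forall>x. ?\<phi> \<^bold>\<longrightarrow> subst_num (Var x \<^bold>+ \<^bold>1) x ?\<phi>) \<^bold>\<longrightarrow> (\<^bold>\<forall>x. ?\<phi>)) \<in> RCA0"
    using assms(1) unfolding RCA0_def Sigma01_induction_def by (blast intro: Sigma01.intros)
  from model[OF this, of e f] have
    "sat M e f (subst_num \<^bold>0 x ?\<phi>) \<Longrightarrow>
      (\<And>a. sat M (e(x := a)) f ?\<phi> \<Longrightarrow> sat M (e(x := a)) f (subst_num (Var x \<^bold>+ \<^bold>1) x ?\<phi>)) \<Longrightarrow>
      sat M (e(x := a)) f ?\<phi>"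
    unfolding sat.simps by blast
  then show ?thesis
    using assms(3,4) sat_subst_num[OF assms(2), of M "e(x := _)" f]
      sat_subst_num[OF num_free_for_closed[of "\<^bold>0"], of M e f x ?\<phi>]
    by simp
qed

text \<open>A vacuous existential quantifier makes a bounded formula \<open>Sigma01\<close>.\<close>

lemma bounded_induct:
  assumes "bounded \<theta>" "num_free_for (Var x \<^bold>+ \<^bold>1) x \<theta>"
    and "sat M (e(x := \<zero>)) f \<theta>"
    and "\<And>a. sat M (e(x := a)) f \<theta> \<Longrightarrow> sat M (e(x := a \<oplus> \<one>)) f \<theta>"
  shows "sat M (e(x := a)) f \<theta>"
proof -
  obtain y where y: "y \<notin> insert x (free_num \<theta>)"
    by (rule fresh_var[of "insert x (free_num \<theta>)"]) auto
  have "sat M e' f (\<^bold>\<exists>y. \<theta>) \<longleftrightarrow> sat M e' f \<theta>" for e'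
    using sat_cong[of \<theta> "e'(y := _)" e' f f M] y by (metis fun_upd_other insertCI sat.simps(4,6))
  then show ?thesis
    using sigma_induct[of \<theta> x y e f a] assms y by simp
qed

text \<open>The axiom is an implication between formulas with parameters, so the two forms need only
  agree in this model under \<open>e\<close> and \<open>f\<close>. In \<open>ex_vicinities\<close>
  the agreement depends on \<open>P\<close> being a function there.\<close>

lemma delta_comprehension:
  assumes "bounded \<theta>" "bounded \<theta>'"
    and "\<And>a. sat M (e(x := a)) f (\<^bold>\<exists>y. \<theta>) \<longleftrightarrow> sat M (e(x := a)) f (\<^bold>\<forall>z. \<theta>')"
  shows "\<exists>D. \<forall>a. a \<epsilon> D \<longleftrightarrow> sat M (e(x := a)) f (\<^bold>\<exists>y. \<theta>)"
proof -
  let ?\<phi> = "\<^bold>\<exists>y. \<theta>" and ?\<psi> = "\<^bold>\<forall>z. \<theta>'"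
  obtain X where X: "X \<notin> free_set ?\<phi>"
    by (rule fresh_var[OF finite_free_set])
  have "((\<^bold>\<forall>x. ?\<phi> \<^bold>\<longleftrightarrow> ?\<psi>) \<^bold>\<longrightarrow> (\<^bold>\<exists>\<^sub>2X. \<^bold>\<forall>x. Var x \<^bold>\<in> X \<^bold>\<longleftrightarrow> ?\<phi>)) \<in> RCA0"
    using assms(1,2) X unfolding RCA0_def Delta01_comprehension_def
    by (blast intro: Sigma01.intros Pi01.intros)
  from model[OF this, of e f] have
    "\<exists>D. \<forall>a. a \<epsilon> D \<longleftrightarrow> sat M (e(x := a)) (f(X := D)) ?\<phi>"
    using assms(3) by simp blast
  moreover have "sat M e' (f(X := D)) ?\<phi> \<longleftrightarrow> sat M e' f ?\<phi>" for e' D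
    by (rule sat_cong) (use X in auto)
  ultimately show ?thesis by simp
qed

lemma bounded_comprehension:
  assumes "bounded \<theta>"
  shows "\<exists>D. \<forall>a. a \<epsilon> D \<longleftrightarrow> sat M (e(x := a)) f \<theta>"
proof -
  obtain y where y: "y \<notin> free_num \<theta>"
    by (rule fresh_var[OF finite_free_num])
  have "sat M (e'(y := d)) f \<theta> \<longleftrightarrow> sat M e' f \<theta>" for e' d
    by (rule sat_cong) (use y in auto)
  then show ?thesis
    using delta_comprehension[OF assms assms, of e x f y y] by simp
qed

section \<open>The semiring laws, by induction on the right-hand argument\<close>

lemma zero_add: "\<zero> \<oplus> a = a"
  using bounded_induct[of "\<^bold>0 \<^bold>+ Var ''x'' \<^bold>= Var ''x''" "''x''" "\<lambda>_. \<zero>" "\<lambda>_. undefined" a]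
  by (simp add: bounded.intros add_zero add_suc)

lemma suc_add: "(a \<oplus> \<one>) \<oplus> b = (a \<oplus> b) \<oplus> \<one>"
  using bounded_induct[of "(Var ''a'' \<^bold>+ \<^bold>1) \<^bold>+ Var ''x'' \<^bold>= (Var ''a'' \<^bold>+ Var ''x'') \<^bold>+ \<^bold>1"
      "''x''" "\<lambda>_. a" "\<lambda>_. undefined" b]
  by (simp add: bounded.intros add_zero add_suc)

lemma add_comm: "a \<oplus> b = b \<oplus> a"
  using bounded_induct[of "Var ''a'' \<^bold>+ Var ''x'' \<^bold>= Var ''x'' \<^bold>+ Var ''a''"
      "''x''" "\<lambda>_. a" "\<lambda>_. undefined" b]
  by (simp add: bounded.intros add_zero zero_add add_suc suc_add)

lemma add_assoc: "(a \<oplus> b) \<oplus> c = a \<oplus> (b \<oplus> c)"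
  using bounded_induct[of "(Var ''a'' \<^bold>+ Var ''b'') \<^bold>+ Var ''x'' \<^bold>= Var ''a'' \<^bold>+ (Var ''b'' \<^bold>+ Var ''x'')"
      "''x''" "(\<lambda>_. a)(''b'' := b)" "\<lambda>_. undefined" c]
  by (simp add: bounded.intros add_zero add_suc)

lemma add_left_comm: "a \<oplus> (b \<oplus> c) = b \<oplus> (a \<oplus> c)"
  by (metis add_assoc add_comm)

lemmas add_ac = add_assoc add_comm add_left_comm

lemma add_right_cancel: "a \<oplus> c = b \<oplus> c \<longleftrightarrow> a = b"
  using bounded_induct[of "Var ''a'' \<^bold>+ Var ''x'' \<^bold>= Var ''b'' \<^bold>+ Var ''x'' \<^bold>\<longrightarrow> Var ''a'' \<^bold>= Var ''b''"
      "''x''" "(\<lambda>_. a)(''b'' := b)" "\<lambda>_. undefined" c]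
  by (auto simp: bounded.intros add_zero add_suc dest: suc_inject)

lemma zero_mult: "\<zero> \<otimes> a = \<zero>"
  using bounded_induct[of "\<^bold>0 \<^bold>* Var ''x'' \<^bold>= \<^bold>0" "''x''" "\<lambda>_. \<zero>" "\<lambda>_. undefined" a]
  by (simp add: bounded.intros mult_zero mult_suc add_zero)

lemma suc_mult: "(a \<oplus> \<one>) \<otimes> b = (a \<otimes> b) \<oplus> b"
  using bounded_induct[of "(Var ''a'' \<^bold>+ \<^bold>1) \<^bold>* Var ''x'' \<^bold>= (Var ''a'' \<^bold>* Var ''x'') \<^bold>+ Var ''x''"
      "''x''" "\<lambda>_. a" "\<lambda>_. undefined" b]
  by (simp add: bounded.intros mult_zero add_zero mult_suc add_ac)

lemma mult_comm: "a \<otimes> b = b \<otimes> a"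
  using bounded_induct[of "Var ''a'' \<^bold>* Var ''x'' \<^bold>= Var ''x'' \<^bold>* Var ''a''"
      "''x''" "\<lambda>_. a" "\<lambda>_. undefined" b]
  by (simp add: bounded.intros mult_zero zero_mult mult_suc suc_mult)

lemma distrib: "a \<otimes> (b \<oplus> c) = a \<otimes> b \<oplus> a \<otimes> c"
  using bounded_induct[of "Var ''a'' \<^bold>* (Var ''b'' \<^bold>+ Var ''x'') \<^bold>= Var ''a'' \<^bold>* Var ''b'' \<^bold>+ Var ''a'' \<^bold>* Var ''x''"
      "''x''" "(\<lambda>_. a)(''b'' := b)" "\<lambda>_. undefined" c]
  by (simp add: bounded.intros add_zero mult_zero mult_suc add_assoc[symmetric])

lemma distrib_right: "(a \<oplus> b) \<otimes> c = a \<otimes> c \<oplus> b \<otimes> c"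
  by (simp add: distrib mult_comm[of _ c])

lemma mult_one: "a \<otimes> \<one> = a" "\<one> \<otimes> a = a"
  using mult_suc[of a "\<zero>"] by (simp_all add: mult_zero zero_add mult_comm[of _ a])

section \<open>Predecessors and the order\<close>

lemma zero_or_suc: "a = \<zero> \<or> (\<exists>b. a = b \<oplus> \<one>)"
  \<comment> \<open>A \<open>Sigma01\<close> formula has to begin with its quantifier, so the case
    distinction is moved inside as an implication.\<close>
  using sigma_induct[of "\<^bold>\<not> Var ''x'' \<^bold>= \<^bold>0 \<^bold>\<longrightarrow> Var ''x'' \<^bold>= Var ''y'' \<^bold>+ \<^bold>1"
      "''x''" "''y''" "\<lambda>_. \<zero>" "\<lambda>_. undefined" a]
  by (auto simp: bounded.intros)

text \<open>The axioms describe the order only at zero and successors. Expressing it by addition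
  makes the semiring laws available for it.\<close>

lemma less_iff: "a \<prec> b \<longleftrightarrow> (\<exists>d. b = a \<oplus> (d \<oplus> \<one>))"
proof
  show "\<exists>d. b = a \<oplus> (d \<oplus> \<one>)" if "a \<prec> b"
  proof -
    \<comment> \<open>The new difference is \<open>d \<oplus> \<one>\<close> if
      \<open>a \<prec> b\<close>, and \<open>\<zero>\<close> if \<open>a = b\<close>.\<close>
    have "\<exists>d. a \<prec> b \<oplus> \<one> \<longrightarrow> b \<oplus> \<one> = a \<oplus> (d \<oplus> \<one>)" if "\<exists>d. a \<prec> b \<longrightarrow> b = a \<oplus> (d \<oplus> \<one>)" for b
      using that by (metis add_suc add_zero less_suc)
    then show ?thesis
      using sigma_induct[of "Var ''a'' \<^bold>< Var ''x'' \<^bold>\<longrightarrow> Var ''x'' \<^bold>= Var ''a'' \<^bold>+ (Var ''y'' \<^bold>+ \<^bold>1)"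
          "''x''" "''y''" "\<lambda>_. a" "\<lambda>_. undefined" b] that
      by (simp add: bounded.intros not_less_zero)
  qed
next
  have "a \<prec> a \<oplus> (d \<oplus> \<one>)" for d
    using bounded_induct[of "Var ''a'' \<^bold>< Var ''a'' \<^bold>+ (Var ''x'' \<^bold>+ \<^bold>1)"
        "''x''" "\<lambda>_. a" "\<lambda>_. undefined" d]
    by (simp add: bounded.intros add_suc add_zero less_suc)
  then show "a \<prec> b" if "\<exists>d. b = a \<oplus> (d \<oplus> \<one>)"
    using that by blast
qed

text \<open>The language has only the strict order, so a bound \<open>b \<oplus> \<one>\<close> is
  the form in which \<le> occurs below, in particular in bounded quantifiers.\<close>

lemma less_suc_iff: "a \<prec> b \<oplus> \<one> \<longleftrightarrow> (\<exists>d. b = a \<oplus> d)"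
  unfolding less_iff by (metis add_assoc suc_inject)

lemma zero_less_suc: "\<zero> \<prec> b \<oplus> \<one>"
  unfolding less_suc_iff by (metis zero_add)

lemma zero_cases: "a = \<zero> \<or> \<zero> \<prec> a"
  using zero_or_suc zero_less_suc by metis

lemma less_suc_trans: "a \<prec> b \<oplus> \<one> \<Longrightarrow> b \<prec> c \<oplus> \<one> \<Longrightarrow> a \<prec> c \<oplus> \<one>"
  unfolding less_suc_iff by (metis add_assoc)

lemma less_irrefl: "\<not> a \<prec> a"
  unfolding less_iff by (metis add_comm add_right_cancel add_zero suc_neq_zero)

lemma less_linear: "a \<prec> b \<or> a = b \<or> b \<prec> a"
proof -
  \<comment> \<open>This is the one case of the induction step that \<open>less_suc\<close> does not
    settle; it splits according to whether \<open>d\<close> is zero or a successor.\<close>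
  have "a \<prec> b \<oplus> \<one> \<or> a = b \<oplus> \<one> \<or> b \<oplus> \<one> \<prec> a" if less: "b \<prec> a" for b
  proof -
    obtain d where d: "a = b \<oplus> (d \<oplus> \<one>)" using less unfolding less_iff by blast
    have "a = (b \<oplus> \<one>) \<oplus> d" unfolding d by (simp only: add_ac)
    then show ?thesis
      using zero_or_suc[of d] add_zero[of "b \<oplus> \<one>"] less_iff[of "b \<oplus> \<one>" a] by auto
  qed
  then show ?thesis
    using bounded_induct[of "Var ''a'' \<^bold>< Var ''x'' \<^bold>\<or> Var ''a'' \<^bold>= Var ''x'' \<^bold>\<or> Var ''x'' \<^bold>< Var ''a''"
        "''x''" "\<lambda>_. a" "\<lambda>_. undefined" b] zero_cases[of a]
    by (simp add: bounded.intros) (metis less_suc)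
qed

lemma suc_less_sucD: "a \<oplus> \<one> \<prec> b \<oplus> \<one> \<Longrightarrow> a \<prec> b"
proof -
  assume "a \<oplus> \<one> \<prec> b \<oplus> \<one>"
  then obtain d where "b \<oplus> \<one> = (a \<oplus> \<one>) \<oplus> (d \<oplus> \<one>)"
    unfolding less_iff by blast
  also have "\<dots> = (a \<oplus> (d \<oplus> \<one>)) \<oplus> \<one>"
    by (simp only: add_ac)
  finally show ?thesis
    unfolding less_iff using suc_inject by blast
qed

section \<open>Pairing\<close>

lemma pr_less:
  assumes "s \<oplus> t \<prec> q"
  shows "pr s t \<prec> q \<otimes> q \<oplus> s'"
proof -
  obtain d where q: "q = (s \<oplus> t) \<oplus> (d \<oplus> \<one>)" using assms less_iff by blast
  \<comment> \<open>For p = s + t the expansion isolates p * p + p, which is at least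
    \<open>pr s t\<close>, and a successor. Thus a code with sum p lies below (p + 1) * (p + 1),
    hence below every code with a larger sum.\<close>
  have "(p \<oplus> (d \<oplus> \<one>)) \<otimes> (p \<oplus> (d \<oplus> \<one>)) =
      p \<otimes> p \<oplus> p \<oplus> ((p \<otimes> d \<oplus> p \<otimes> d \<oplus> p \<oplus> d \<otimes> d \<oplus> d \<oplus> d) \<oplus> \<one>)" for p
    by (simp add: distrib distrib_right mult_one mult_comm[of d p] add_ac)
  then obtain r where "q \<otimes> q = (s \<oplus> t) \<otimes> (s \<oplus> t) \<oplus> (s \<oplus> t) \<oplus> (r \<oplus> \<one>)"
    unfolding q by blast
  then have "q \<otimes> q \<oplus> s' = pr s t \<oplus> ((t \<oplus> r \<oplus> s') \<oplus> \<one>)"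
    by (simp add: add_ac)
  then show ?thesis
    unfolding less_iff by blast
qed

text \<open>Codes with different sums are separated by \<open>pr_less\<close>, so the sum can be
  read off; cancelling its square leaves the first component, and cancelling that from the sum
  leaves the second.\<close>

lemma pr_inject: "pr s t = pr s' t' \<longleftrightarrow> s = s' \<and> t = t'"
proof
  assume eq: "pr s t = pr s' t'"
  then have sum: "s \<oplus> t = s' \<oplus> t'"
    using less_linear[of "s \<oplus> t" "s' \<oplus> t'"] pr_less less_irrefl by metis
  then have "s = s'"
    using eq by (metis add_comm add_right_cancel)
  then show "s = s' \<and> t = t'"
    using sum by (metis add_comm add_right_cancel)
qed simp

text \<open>With both components bounded by the code, quantifiers over the components of a coded
  pair become bounded; this is how the sets of pairs below fall under comprehension.\<close>

lemma fst_le_pr: "s \<prec> pr s t \<oplus> \<one>"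
  unfolding less_suc_iff by (metis add_comm)

lemma snd_le_pr: "t \<prec> pr s t \<oplus> \<one>"
proof -
  \<comment> \<open>This is p \<le> p * p: clear for zero, and for
    \<open>p = b \<oplus> \<one>\<close> it holds because
    \<open>p \<otimes> p = p \<otimes> b \<oplus> p\<close>.\<close>
  have "\<exists>d. p \<otimes> p = p \<oplus> d" for p
    using zero_or_suc[of p] by (metis add_comm add_zero mult_suc mult_zero)
  then show ?thesis
    unfolding less_suc_iff by (metis add_ac)
qed

end

section \<open>V-spaces in models of RCA0\<close>

context rca0_model
begin

section \<open>The meaning of the formula templates in a model\<close>

definition func :: "'s \<Rightarrow> 's \<Rightarrow> 's \<Rightarrow> bool" where
  "func P X Y \<longleftrightarrow> (\<forall>z. z \<epsilon> P \<longrightarrow> (\<exists>x y. x \<epsilon> X \<and> y \<epsilon> Y \<and> z = pr x y)) \<and>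
    (\<forall>x. x \<epsilon> X \<longrightarrow> (\<exists>y. pr x y \<epsilon> P \<and> (\<forall>y'. pr x y' \<epsilon> P \<longrightarrow> y' = y)))"

definition same :: "'s \<Rightarrow> 'n \<Rightarrow> 'n \<Rightarrow> bool" where
  "same P a b \<longleftrightarrow> (\<exists>w. pr a w \<epsilon> P \<and> pr b w \<epsilon> P)"

definition vspace :: "'s \<Rightarrow> 's \<Rightarrow> 's \<Rightarrow> bool" where
  "vspace X I S \<longleftrightarrow> (\<exists>x. x \<epsilon> X) \<and>
    (\<forall>x. x \<epsilon> X \<longrightarrow>
      (\<exists>n. pr n x \<epsilon> I) \<and>
      (\<forall>n. pr n x \<epsilon> I \<longrightarrow> (\<forall>m. m \<prec> n \<longrightarrow> pr m x \<epsilon> I)) \<and>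
      (\<forall>n. pr n x \<epsilon> I \<longrightarrow> pr (pr x n) x \<epsilon> S \<and> (\<forall>y. pr (pr y n) x \<epsilon> S \<longrightarrow> y \<epsilon> X)) \<and>
      (\<forall>n. pr n x \<epsilon> I \<longrightarrow> (\<forall>m. pr m x \<epsilon> I \<longrightarrow> n = m \<or>
        (\<exists>y. pr (pr y n) x \<epsilon> S \<and> \<not> pr (pr y m) x \<epsilon> S \<or> pr (pr y m) x \<epsilon> S \<and> \<not> pr (pr y n) x \<epsilon> S))))"

definition induced :: "'s \<Rightarrow> 's \<Rightarrow> 's \<Rightarrow> 's \<Rightarrow> bool" where
  "induced P X I S \<longleftrightarrow> vspace X I S \<and>
    (\<forall>x n. x \<epsilon> X \<and> pr n x \<epsilon> I \<longrightarrow> (\<forall>y. pr (pr y n) x \<epsilon> S \<longleftrightarrow> y \<epsilon> X \<and> same P x y))"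

definition cover :: "'s \<Rightarrow> 's \<Rightarrow> 's \<Rightarrow> 's \<Rightarrow> bool" where
  "cover X I S V \<longleftrightarrow>
    (\<forall>x. x \<epsilon> X \<longrightarrow> (\<exists>n. pr n x \<epsilon> I \<and> (\<forall>y. pr y x \<epsilon> V \<longleftrightarrow> pr (pr y n) x \<epsilon> S)))"

definition finseq :: "'s \<Rightarrow> 'n \<Rightarrow> 's \<Rightarrow> bool" where
  "finseq F k X \<longleftrightarrow> (\<forall>z. z \<epsilon> F \<longrightarrow> (\<exists>i u. i \<prec> k \<oplus> \<one> \<and> u \<epsilon> X \<and> z = pr i u)) \<and>
    (\<forall>i. i \<prec> k \<oplus> \<one> \<longrightarrow> (\<exists>u. pr i u \<epsilon> F \<and> (\<forall>u'. pr i u' \<epsilon> F \<longrightarrow> u' = u)))"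

definition chain :: "'s \<Rightarrow> 's \<Rightarrow> 'n \<Rightarrow> 's \<Rightarrow> 'n \<Rightarrow> 'n \<Rightarrow> bool" where
  "chain X F k V a b \<longleftrightarrow> pr \<zero> a \<epsilon> F \<and> finseq F k X \<and> pr k b \<epsilon> F \<and>
    (\<forall>j. j \<prec> k \<longrightarrow> (\<exists>u v. pr j u \<epsilon> F \<and> pr (j \<oplus> \<one>) v \<epsilon> F \<and> (\<exists>y. pr y u \<epsilon> V \<and> pr y v \<epsilon> V)))"

lemma sat_is_function: "sat M e f (is_function P X Y) \<longleftrightarrow> func (f P) (f X) (f Y)"
  unfolding is_function_def func_def pair_def Let_def by simp

text \<open>The template binds \<open>w\<close> without renaming, hence the side conditions.\<close>

lemma sat_same_value:
  "''w'' \<noteq> x \<Longrightarrow> ''w'' \<noteq> y \<Longrightarrow> sat M e f (same_value P (Var x) (Var y)) \<longleftrightarrow> same (f P) (e x) (e y)"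
  unfolding same_value_def same_def pair_def Let_def by simp

lemma sat_strong_V_space: "sat M e f (strong_V_space X I S) \<longleftrightarrow> vspace (f X) (f I) (f S)"
  unfolding strong_V_space_def vspace_def is_index_def in_vicinity_def pair_def Let_def
  by simp

lemma sat_induced_V_space: "sat M e f (induced_V_space P X I S) \<longleftrightarrow> induced (f P) (f X) (f I) (f S)"
  unfolding induced_V_space_def induced_def is_index_def in_vicinity_def pair_def Let_def
  by (simp add: sat_strong_V_space sat_same_value) blast

lemma sat_is_cover: "sat M e f (is_cover X I S V) \<longleftrightarrow> cover (f X) (f I) (f S) (f V)"
  unfolding is_cover_def cover_def is_index_def in_vicinity_def pair_def Let_def
  by simp blast

lemma sat_is_finite_sequence:
  "sat M e f (is_finite_sequence F (Var ''k'') X) \<longleftrightarrow> finseq (f F) (e ''k'') (f X)"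
  unfolding is_finite_sequence_def finseq_def pair_def Let_def by simp

lemma sat_connected:
  "sat M e f (connected ''X'' ''I'' ''S'' (Var ''a'') (Var ''b'')) \<longleftrightarrow>
    (\<forall>V. cover (f ''X'') (f ''I'') (f ''S'') V \<longrightarrow> (\<exists>F k. chain (f ''X'') F k V (e ''a'') (e ''b'')))"
  unfolding connected_def chain_def pair_def Let_def
  by (simp add: sat_is_cover sat_is_finite_sequence)

section \<open>Existence of the induced V-space and of covers\<close>

lemma function_value:
  assumes "func P X Y" "x \<epsilon> X"
  obtains w where "pr x w \<epsilon> P" "\<And>w'. pr x w' \<epsilon> P \<Longrightarrow> w' = w"
  using assms unfolding func_def by blast

text \<open>Every element of \<open>P\<close> codes a pair with first component in \<open>X\<close>;
  injectivity of pairing transfers this to \<open>x\<close>, where uniqueness of values is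
  available.\<close>

lemma function_unique:
  assumes P: "func P X Y" and w: "pr x w \<epsilon> P" "pr x w' \<epsilon> P"
  shows "w = w'"
proof -
  obtain x' y where "x' \<epsilon> X" "pr x w = pr x' y"
    using P w(1) unfolding func_def by blast
  then have "x \<epsilon> X" by (simp only: pr_inject)
  from function_value[OF P this] show ?thesis using w by metis
qed

text \<open>Every point gets the single index \<open>\<zero>\<close>. The point is recovered from
  the code by a quantifier that the code bounds.\<close>

lemma ex_index_set: "\<exists>I. \<forall>n x. pr n x \<epsilon> I \<longleftrightarrow> n = \<zero> \<and> x \<epsilon> X"
proof -
  let ?\<theta> = "\<^bold>\<exists>''x''. Var ''x'' \<^bold>< Var ''z'' \<^bold>+ \<^bold>1 \<^bold>\<and>
    (Var ''x'' \<^bold>\<in> ''X'' \<^bold>\<and> Var ''z'' \<^bold>= pair \<^bold>0 (Var ''x''))"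
  have "bounded ?\<theta>"
    by (intro bounded.intros(7)) (auto intro!: bounded.intros)
  then obtain I where I: "\<And>z. z \<epsilon> I \<longleftrightarrow> sat M ((\<lambda>_. \<zero>)(''z'' := z)) (\<lambda>_. X) ?\<theta>"
    using bounded_comprehension by blast
  have "z \<epsilon> I \<longleftrightarrow> (\<exists>x. x \<prec> z \<oplus> \<one> \<and> x \<epsilon> X \<and> z = pr \<zero> x)" for z
    unfolding I by (auto simp: pair_def)
  then have "\<forall>n x. pr n x \<epsilon> I \<longleftrightarrow> n = \<zero> \<and> x \<epsilon> X"
    using snd_le_pr pr_inject by metis
  then show ?thesis by blast
qed

text \<open>That \<open>x\<close> and \<open>y\<close> have the same value is \<open>\<Sigma>\<^sup>0\<^sub>1\<close> by definition, and \<open>\<Pi>\<^sup>0\<^sub>1\<close> because every value of \<open>x\<close> is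
  then a value of \<open>y\<close>.\<close>
lemma ex_vicinities:
  assumes P: "func P X Y"
  shows "\<exists>S. \<forall>x y. pr (pr y \<zero>) x \<epsilon> S \<longleftrightarrow> x \<epsilon> X \<and> y \<epsilon> X \<and> same P x y"
proof -
  let ?x = "Var ''x''" and ?y = "Var ''y''" and ?z = "Var ''z''" and ?w = "Var ''w''"
  \<comment> \<open>\<open>?Q\<close> decodes \<open>z\<close> by bounded quantifiers. The value
    \<open>w\<close> has no bound in terms of \<open>z\<close>, so its quantifier has to stay
    outside, and the decoding is repeated for each \<open>w\<close>.\<close>
  let ?Q = "\<lambda>\<phi>. \<^bold>\<exists>''x''. ?x \<^bold>< ?z \<^bold>+ \<^bold>1 \<^bold>\<and> (\<^bold>\<exists>''y''. ?y \<^bold>< ?z \<^bold>+ \<^bold>1 \<^bold>\<and>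
    (?x \<^bold>\<in> ''X'' \<^bold>\<and> ?y \<^bold>\<in> ''X'' \<^bold>\<and> ?z \<^bold>= pair (pair ?y \<^bold>0) ?x \<^bold>\<and> \<phi>))"
  let ?\<sigma> = "pair ?x ?w \<^bold>\<in> ''P'' \<^bold>\<and> pair ?y ?w \<^bold>\<in> ''P''"
  let ?\<pi> = "pair ?x ?w \<^bold>\<in> ''P'' \<^bold>\<longrightarrow> pair ?y ?w \<^bold>\<in> ''P''"
  let ?f = "(\<lambda>_. X)(''P'' := P)"
  have le: "x \<prec> pr (pr y \<zero>) x \<oplus> \<one>" "y \<prec> pr (pr y \<zero>) x \<oplus> \<one>" for x y
    using snd_le_pr fst_le_pr less_suc_trans by blast+
  have bounded_Q: "bounded (?Q \<phi>)" if "bounded \<phi>" for \<phi>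
    by (intro bounded.intros(7)) (use that in \<open>auto intro!: bounded.intros\<close>)
  have sat_\<sigma>: "sat M ((\<lambda>_. \<zero>)(''z'' := z)) ?f (\<^bold>\<exists>''w''. ?Q ?\<sigma>) \<longleftrightarrow>
      (\<exists>x y. x \<epsilon> X \<and> y \<epsilon> X \<and> z = pr (pr y \<zero>) x \<and> same P x y)" for z
    using le by (simp add: pair_def same_def) metis
  have sat_\<pi>: "sat M ((\<lambda>_. \<zero>)(''z'' := z)) ?f (\<^bold>\<forall>''w''. ?Q ?\<pi>) \<longleftrightarrow>
      (\<forall>w. \<exists>x y. x \<epsilon> X \<and> y \<epsilon> X \<and> z = pr (pr y \<zero>) x \<and> (pr x w \<epsilon> P \<longrightarrow> pr y w \<epsilon> P))" for z
    using le by (simp add: pair_def) metis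
  have \<sigma>\<pi>: "sat M ((\<lambda>_. \<zero>)(''z'' := z)) ?f (\<^bold>\<exists>''w''. ?Q ?\<sigma>) \<longleftrightarrow>
      sat M ((\<lambda>_. \<zero>)(''z'' := z)) ?f (\<^bold>\<forall>''w''. ?Q ?\<pi>)" for z
    unfolding sat_\<sigma> sat_\<pi>
  proof
    assume "\<exists>x y. x \<epsilon> X \<and> y \<epsilon> X \<and> z = pr (pr y \<zero>) x \<and> same P x y"
    then show "\<forall>w. \<exists>x y. x \<epsilon> X \<and> y \<epsilon> X \<and> z = pr (pr y \<zero>) x \<and> (pr x w \<epsilon> P \<longrightarrow> pr y w \<epsilon> P)"
      using function_unique[OF P] unfolding same_def by metis
  next
    assume R: "\<forall>w. \<exists>x y. x \<epsilon> X \<and> y \<epsilon> X \<and> z = pr (pr y \<zero>) x \<and> (pr x w \<epsilon> P \<longrightarrow> pr y w \<epsilon> P)"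
    then obtain x y where xy: "x \<epsilon> X" "y \<epsilon> X" "z = pr (pr y \<zero>) x" by blast
    \<comment> \<open>At the value \<open>w\<close> of \<open>x\<close> the premise of the
      implication holds. The components found for this \<open>w\<close> are \<open>x\<close> and
      \<open>y\<close> again, because the coding is injective.\<close>
    obtain w where w: "pr x w \<epsilon> P" using function_value[OF P xy(1)] by blast
    obtain x' y' where "z = pr (pr y' \<zero>) x'" "pr x' w \<epsilon> P \<longrightarrow> pr y' w \<epsilon> P"
      using R by blast
    moreover from this have "x' = x" "y' = y" using xy(3) pr_inject by metis+
    ultimately show "\<exists>x y. x \<epsilon> X \<and> y \<epsilon> X \<and> z = pr (pr y \<zero>) x \<and> same P x y"
      using xy w unfolding same_def by blast
  qed
  have "bounded (?Q ?\<sigma>)" "bounded (?Q ?\<pi>)"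
    by (intro bounded_Q bounded.intros)+
  then have "\<exists>S. \<forall>z. z \<epsilon> S \<longleftrightarrow> sat M ((\<lambda>_. \<zero>)(''z'' := z)) ?f (\<^bold>\<exists>''w''. ?Q ?\<sigma>)"
    using \<sigma>\<pi> by (rule delta_comprehension)
  then show ?thesis
    unfolding sat_\<sigma> by (metis pr_inject)
qed

text \<open>With \<open>\<zero>\<close> as the only index, the clauses on initial segments and on
  distinct vicinities are vacuous. Totality of \<open>P\<close> puts every point into its own fibre,
  and \<open>a\<close> makes \<open>X\<close> non-empty.\<close>

lemma ex_induced:
  assumes P: "func P X Y" and a: "a \<epsilon> X"
  shows "\<exists>I S. induced P X I S"
proof -
  obtain I where I: "\<And>n x. pr n x \<epsilon> I \<longleftrightarrow> n = \<zero> \<and> x \<epsilon> X" using ex_index_set by blast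
  obtain S where S: "\<And>x y. pr (pr y \<zero>) x \<epsilon> S \<longleftrightarrow> x \<epsilon> X \<and> y \<epsilon> X \<and> same P x y"
    using ex_vicinities[OF P] by blast
  have "same P x x" if "x \<epsilon> X" for x
    using function_value[OF P that] unfolding same_def by blast
  then have "induced P X I S"
    unfolding induced_def vspace_def using I S a not_less_zero by auto
  then show ?thesis by blast
qed

text \<open>Index sets are non-empty initial segments, so \<open>\<zero>\<close> is an index for
  every point. Taking it everywhere avoids choosing indices, and the cover becomes definable by a
  bounded formula.\<close>

lemma ex_cover:
  assumes "vspace X I S"
  shows "\<exists>V. cover X I S V"
proof -
  let ?x = "Var ''x''" and ?y = "Var ''y''" and ?z = "Var ''z''"
  let ?\<theta> = "\<^bold>\<exists>''x''. ?x \<^bold>< ?z \<^bold>+ \<^bold>1 \<^bold>\<and> (\<^bold>\<exists>''y''. ?y \<^bold>< ?z \<^bold>+ \<^bold>1 \<^bold>\<and>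
    (?z \<^bold>= pair ?y ?x \<^bold>\<and> pair (pair ?y \<^bold>0) ?x \<^bold>\<in> ''S''))"
  have "bounded ?\<theta>"
    by (intro bounded.intros(7)) (auto intro!: bounded.intros)
  then obtain V where V: "\<And>z. z \<epsilon> V \<longleftrightarrow> sat M ((\<lambda>_. \<zero>)(''z'' := z)) (\<lambda>_. S) ?\<theta>"
    using bounded_comprehension by blast
  have "z \<epsilon> V \<longleftrightarrow> (\<exists>x y. x \<prec> z \<oplus> \<one> \<and> y \<prec> z \<oplus> \<one> \<and> z = pr y x \<and> pr (pr y \<zero>) x \<epsilon> S)" for z
    unfolding V by (auto simp: pair_def)
  then have V: "pr y x \<epsilon> V \<longleftrightarrow> pr (pr y \<zero>) x \<epsilon> S" for x y
    using snd_le_pr fst_le_pr pr_inject by metis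
  have "pr \<zero> x \<epsilon> I" if "x \<epsilon> X" for x
    using assms that zero_cases unfolding vspace_def by metis
  then have "cover X I S V"
    unfolding cover_def using V by blast
  then show ?thesis by blast
qed

lemma not_connected:
  assumes P: "func P X Y" and a: "a \<epsilon> X" and ab: "\<not> same P a b" and ind: "induced P X I S"
  shows "\<exists>V. cover X I S V \<and> \<not> (\<exists>F k. chain X F k V a b)"
proof -
  have "vspace X I S" using ind unfolding induced_def by blast
  then obtain V where V: "cover X I S V" using ex_cover by blast
  \<comment> \<open>Whichever index the cover uses at \<open>x\<close>, the vicinity there is the
    fibre of \<open>x\<close>.\<close>
  have V_iff: "pr y x \<epsilon> V \<longleftrightarrow> y \<epsilon> X \<and> same P x y" if "x \<epsilon> X" for x y
    using that V ind unfolding cover_def induced_def by metis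
  have "False" if ch: "chain X F k V a b" for F k
  proof -
    have F: "finseq F k X" and Fa: "pr \<zero> a \<epsilon> F" and Fb: "pr k b \<epsilon> F"
      and link: "\<And>j. j \<prec> k \<Longrightarrow> \<exists>u v y. pr j u \<epsilon> F \<and> pr (j \<oplus> \<one>) v \<epsilon> F \<and> pr y u \<epsilon> V \<and> pr y v \<epsilon> V"
      using ch unfolding chain_def by blast+
    have F_mem: "u \<epsilon> X" if ju: "pr j u \<epsilon> F" for j u
    proof -
      obtain i v where "v \<epsilon> X" "pr j u = pr i v"
        using F ju unfolding finseq_def by blast
      then show ?thesis by (simp only: pr_inject)
    qed
    have F_unique: "u = u'" if "pr j u \<epsilon> F" "pr j u' \<epsilon> F" "j \<prec> k \<oplus> \<one>" for j u u'
      using F that unfolding finseq_def by metis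
    \<comment> \<open>Naming the value of \<open>a\<close> once leaves the induction formula with
      one existential quantifier, over the term of the chain, and a quantifier-free matrix.\<close>
    obtain c where c: "pr a c \<epsilon> P" using function_value[OF P a] by blast
    \<comment> \<open>The guard makes the property trivial for indices beyond \<open>k\<close>, as
      the induction runs through all numbers of the model.\<close>
    let ?\<theta> = "Var ''j'' \<^bold>< Var ''k'' \<^bold>+ \<^bold>1 \<^bold>\<longrightarrow> pair (Var ''j'') (Var ''u'') \<^bold>\<in> ''F'' \<^bold>\<and> pair (Var ''u'') (Var ''c'') \<^bold>\<in> ''P''"
    let ?e = "(\<lambda>_. c)(''k'' := k)" and ?f = "(\<lambda>_. F)(''P'' := P)"
    have sat_\<theta>: "sat M (?e(''j'' := j)) ?f (\<^bold>\<exists>''u''. ?\<theta>) \<longleftrightarrow>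
        (\<exists>u. j \<prec> k \<oplus> \<one> \<longrightarrow> pr j u \<epsilon> F \<and> pr u c \<epsilon> P)" for j
      by (simp add: pair_def)
    have "sat M (?e(''j'' := k)) ?f (\<^bold>\<exists>''u''. ?\<theta>)"
    proof (rule sigma_induct)
      show "bounded ?\<theta>" by (auto intro!: bounded.intros)
      show "num_free_for (Var ''j'' \<^bold>+ \<^bold>1) ''j'' (\<^bold>\<exists>''u''. ?\<theta>)" by simp
      show "sat M (?e(''j'' := \<zero>)) ?f (\<^bold>\<exists>''u''. ?\<theta>)"
        unfolding sat_\<theta> using Fa c by blast
      fix j
      assume IH: "sat M (?e(''j'' := j)) ?f (\<^bold>\<exists>''u''. ?\<theta>)"
      have "\<exists>v. pr (j \<oplus> \<one>) v \<epsilon> F \<and> pr v c \<epsilon> P" if "j \<oplus> \<one> \<prec> k \<oplus> \<one>"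
      proof -
        have jk: "j \<prec> k"
          using that by (rule suc_less_sucD)
        then have jk': "j \<prec> k \<oplus> \<one>" by (simp add: less_suc)
        obtain u where u: "pr j u \<epsilon> F" "pr u c \<epsilon> P"
          using IH jk' unfolding sat_\<theta> by blast
        obtain u' v y where v: "pr j u' \<epsilon> F" "pr (j \<oplus> \<one>) v \<epsilon> F" "pr y u' \<epsilon> V" "pr y v \<epsilon> V"
          using link[OF jk] by blast
        \<comment> \<open>The link comes with its own term at \<open>j\<close>; uniqueness
          identifies it with the one from the induction hypothesis. The point \<open>y\<close>
          common to both fibres then carries the value \<open>c\<close> over to
          \<open>v\<close>.\<close>
        have "u' = u" using F_unique u(1) v(1) jk' by blast
        then have "same P u y" "same P v y"
          using V_iff F_mem u(1) v by blast+
        then have "pr v c \<epsilon> P"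
          using u(2) function_unique[OF P] unfolding same_def by metis
        then show ?thesis using v(2) by blast
      qed
      then show "sat M (?e(''j'' := j \<oplus> \<one>)) ?f (\<^bold>\<exists>''u''. ?\<theta>)"
        unfolding sat_\<theta> by blast
    qed
    then obtain u where "pr k u \<epsilon> F" "pr u c \<epsilon> P"
      unfolding sat_\<theta> by (auto simp: less_suc)
    then have "pr b c \<epsilon> P"
      using F_unique[OF _ Fb] by (auto simp: less_suc)
    then show False using c ab unfolding same_def by blast
  qed
  then show ?thesis using V by blast
qed

end

section \<open>Distinct numerals\<close>

lemma proves_eq_sym: "T \<turnstile> s \<^bold>= t \<^bold>\<longrightarrow> t \<^bold>= s"
proof -
  obtain x where x: "x \<notin> vars_tm s" by (rule fresh_var[OF finite_vars_tm])
  have "T \<turnstile> s \<^bold>= t \<^bold>\<longrightarrow> s \<^bold>= s \<^bold>\<longrightarrow> t \<^bold>= s"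
    using Leibniz[of s x "Var x \<^bold>= s" t T] x by simp
  then show ?thesis using proves_imp_mp proves_weaken Refl by blast
qed

lemma vars_num [simp]: "vars_tm (num i) = {}"
  by (induction i) auto

lemma proves_num_suc_neq: "RCA0 \<turnstile> \<^bold>\<not> num (Suc i) \<^bold>= num 0"
proof -
  have "RCA0 \<turnstile> \<^bold>\<forall>''n''. \<^bold>\<not> (Var ''n'' \<^bold>+ \<^bold>1 \<^bold>= \<^bold>0)"
    by (intro Gen_num Axiom) (simp add: RCA0_def basic_axioms_def Let_def)
  from MP[OF Inst_num[of "num i"] this] show ?thesis by simp
qed

lemma proves_num_suc_inject: "RCA0 \<turnstile> num (Suc i) \<^bold>= num (Suc j) \<^bold>\<longrightarrow> num i \<^bold>= num j"
proof -
  have "RCA0 \<turnstile> \<^bold>\<forall>''m''. Var ''m'' \<^bold>+ \<^bold>1 \<^bold>= Var ''n'' \<^bold>+ \<^bold>1 \<^bold>\<longrightarrow> Var ''m'' \<^bold>= Var ''n''"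
    by (intro Gen_num Axiom) (simp add: RCA0_def basic_axioms_def Let_def)
  from MP[OF Inst_num[of "num i"] this]
  have "RCA0 \<turnstile> \<^bold>\<forall>''n''. num i \<^bold>+ \<^bold>1 \<^bold>= Var ''n'' \<^bold>+ \<^bold>1 \<^bold>\<longrightarrow> num i \<^bold>= Var ''n''"
    by (intro Gen_num) simp
  from MP[OF Inst_num[of "num j"] this] show ?thesis by simp
qed

text \<open>This has to be derived inside the calculus, since \<open>completeness\<close>
  presupposes it. The induction is on the indices outside the formal theory and strips successors
  until one side is zero.\<close>

lemma proves_num_neq: "i \<noteq> j \<Longrightarrow> RCA0 \<turnstile> \<^bold>\<not> num i \<^bold>= num j"
proof (induction i j rule: diff_induct)
  case (1 i)
  then show ?case using proves_num_suc_neq not0_implies_Suc by metis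
next
  case (2 j)
  show ?case by (rule MP[OF proves_contrapos[OF proves_eq_sym] proves_num_suc_neq])
next
  case (3 i j)
  then show ?case using MP[OF proves_contrapos[OF proves_num_suc_inject]] by blast
qed

theorem theorem2p5:
  shows "RCA0 \<turnstile>
    \<^bold>\<forall>\<^sub>2''X''. \<^bold>\<forall>\<^sub>2''Y''. \<^bold>\<forall>\<^sub>2''P''. is_function ''P'' ''X'' ''Y'' \<^bold>\<longrightarrow>
      (\<^bold>\<forall>''a''. \<^bold>\<forall>''b''.
        Var ''a'' \<^bold>\<in> ''X'' \<^bold>\<and> Var ''b'' \<^bold>\<in> ''X'' \<^bold>\<and> \<^bold>\<not> same_value ''P'' (Var ''a'') (Var ''b'') \<^bold>\<longrightarrow>
          (\<^bold>\<exists>\<^sub>2''I''. \<^bold>\<exists>\<^sub>2''S''. induced_V_space ''P'' ''X'' ''I'' ''S'') \<^bold>\<and>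
          (\<^bold>\<forall>\<^sub>2''I''. \<^bold>\<forall>\<^sub>2''S''. induced_V_space ''P'' ''X'' ''I'' ''S'' \<^bold>\<longrightarrow>
            \<^bold>\<not> connected ''X'' ''I'' ''S'' (Var ''a'') (Var ''b'')))"
proof (rule completeness)
  show "RCA0 \<turnstile> \<^bold>\<not> num i \<^bold>= num j" if "i \<noteq> j" for i j
    using that by (rule proves_num_neq)
next
  fix M :: "(nat, var) struct" and e f
  assume "\<And>\<psi> e f. \<psi> \<in> RCA0 \<Longrightarrow> sat M e f \<psi>"
  then interpret rca0_model M by unfold_locales
  show "sat M e f (
    \<^bold>\<forall>\<^sub>2''X''. \<^bold>\<forall>\<^sub>2''Y''. \<^bold>\<forall>\<^sub>2''P''. is_function ''P'' ''X'' ''Y'' \<^bold>\<longrightarrow>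
      (\<^bold>\<forall>''a''. \<^bold>\<forall>''b''.
        Var ''a'' \<^bold>\<in> ''X'' \<^bold>\<and> Var ''b'' \<^bold>\<in> ''X'' \<^bold>\<and> \<^bold>\<not> same_value ''P'' (Var ''a'') (Var ''b'') \<^bold>\<longrightarrow>
          (\<^bold>\<exists>\<^sub>2''I''. \<^bold>\<exists>\<^sub>2''S''. induced_V_space ''P'' ''X'' ''I'' ''S'') \<^bold>\<and>
          (\<^bold>\<forall>\<^sub>2''I''. \<^bold>\<forall>\<^sub>2''S''. induced_V_space ''P'' ''X'' ''I'' ''S'' \<^bold>\<longrightarrow>
            \<^bold>\<not> connected ''X'' ''I'' ''S'' (Var ''a'') (Var ''b''))))"
    using ex_induced not_connected
    by (simp add: sat_is_function sat_same_value sat_induced_V_space sat_connected) metis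
qed

end
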